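(* Let $f\in L^2(Q,\mathbb{R})$ and $w\in S^\infty(Q,(0,\infty))$. Then there exist dyadic grids $G_n$ on $Q$ and $G_n$-constant functions $f_n:Q\to\mathbb{R}$ and $w_n:Q\to(0,\infty)$ ($n\in\mathbb{N}$) such that $f_n\to f$ with respect to $\|\cdot\|_2$, $w_n\to w$ with respect to $\|\cdot\|_\infty$, and $$p_\sigma^{w_n}(f_n)\longrightarrow p_\sigma^w(f)\quad\text{with respect to }\|\cdot\|_2\qquad(n\to\infty).$$ In particular, $S_\sigma(Q,\mathbb{R})$ is dense with respect to $\|\cdot\|_2$ in $L^2_\sigma(Q,\mathbb{R})$. Additionally, in the special case where $w$ itself is dyadically grid-constant, one has $$\|p_\sigma^w(f_n)-p_\sigma^w(f)\|_2\le C\,\|f_n-f\|_2,$$ where $C:=(\overline c/\underline c)^{1/2}$, $\underline c:=\operatorname{ess\,inf}_{x\in Q}w(x)$ and $\overline c:=\operatorname{ess\,sup}_{x\in Q}w(x)$.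
   Context: Let $Q=[a_1,b_1]\times\dots\times[a_d,b_d]\subset\mathbb{R}^d$ with $a_i<b_i$, and $\sigma\in\{-1,0,1\}^d$. For $x,y\in\mathbb{R}^d$ write $x\le_\sigma y$ iff $\sigma_ix_i\le\sigma_iy_i$ for all $i$ with $\sigma_i=\pm1$ and $x_i=y_i$ for all $i$ with $\sigma_i=0$. For $X\subset\mathbb{R}^d$, a function $f:X\to\mathbb{R}$ is $\sigma$-monotonic iff $x\le_\sigma y$ implies $f(x)\le f(y)$ for all $x,y\in X$. $L^2_\sigma(Q,\mathbb{R})$ is the set of $f\in L^2(Q,\mathbb{R})$ (Lebesgue measure) such that some (equivalently every) representative $f_0$ of $f$ is $\sigma$-monotonic on $Q\setminus N$ for some null set $N$. For a measurable $w$ on $Q$ bounded (a.e.) above and below by positive constants and $f\in L^2(Q,\mathbb{R})$, $p_\sigma^w(f)$ denotes the unique minimizer of $g\mapsto\int_Q|f(x)-g(x)|^2w(x)\,dx$ over $g\in L^2_\sigma(Q,\mathbb{R})$. $\|\cdot\|_2$ and $\|\cdot\|_\infty$ are the (unweighted) $L^2$-norm and the essential supremum norm on $Q$ with Lebesgue measure. Grids: given partitions $a_i=t_{i0}<t_{i1}<\dots<t_{im_i}=b_i$ of $[a_i,b_i]$ for $i=1,\dots,d$, the associated grid on $Q$ is $G=G_1\times\dots\times G_d$ with $G_i=\{(t_{i,k-1}+t_{ik})/2:k=1,\dots,m_i\}$. It is dyadic iff there is an $n\in\mathbb{N}$ (independent of $i$) such that $m_i=2^n$ and $t_{ik}-t_{i,k-1}=(b_i-a_i)/2^n$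 for all $i$ and $k\in\{1,\dots,2^n\}$. A cell of $G$ is a set $I_1\times\dots\times I_d$ where each $I_i$ is either $[t_{i,k-1},t_{ik})$ for some $k\in\{1,\dots,m_i-1\}$ or $[t_{i,m_i-1},t_{im_i}]$. A function on $Q$ is $G$-constant iff it is constant on each cell of $G$; an equivalence class of functions is $G$-constant iff it has a $G$-constant representative. A function or class is dyadically grid-constant iff it is $G$-constant for some dyadic grid $G$ on $Q$. $S(Q,I)$ is the set of dyadically grid-constant functions on $Q$ with values in $I\subset\mathbb{R}$; $S_\sigma(Q,I)$ is the set of $\sigma$-monotonic $f\in S(Q,I)$; $S^\infty(Q,(0,\infty)):=\bigcup_{c\in(0,\infty)}\overline{S(Q,[c,\infty))}^{\|\cdot\|_\infty}$ (closures in $L^\infty(Q,\mathbb{R})$). Every $w\in S^\infty(Q,(0,\infty))$ is a.e. bounded above and below by positive constants. *)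

theory Defs
  imports "HOL-Probability.Essential_Supremum"
begin

text \<open>Elements of \<open>L\<^sup>2(Q)\<close> and \<open>L\<^sup>\<infinity>(Q)\<close> are represented by functions on the whole space of which
  only the restriction to \<open>Q\<close> matters; every notion below that is applied to a class is invariant
  under changing the function on a Lebesgue null subset of \<open>Q\<close>.\<close>

section \<open>Monotonicity\<close>

definition le_sigma :: "int ^ 'd \<Rightarrow> real ^ 'd \<Rightarrow> real ^ 'd \<Rightarrow> bool" where
  "le_sigma \<sigma> x y \<longleftrightarrow>
     (\<forall>i. (\<sigma> $ i = 1 \<or> \<sigma> $ i = -1 \<longrightarrow> of_int (\<sigma> $ i) * x $ i \<le> of_int (\<sigma> $ i) * y $ i) \<and>
          (\<sigma> $ i = 0 \<longrightarrow> x $ i = y $ i))"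

definition sigma_monotonic :: "int ^ 'd \<Rightarrow> (real ^ 'd) set \<Rightarrow> (real ^ 'd \<Rightarrow> real) \<Rightarrow> bool" where
  "sigma_monotonic \<sigma> X f \<longleftrightarrow> (\<forall>x\<in>X. \<forall>y\<in>X. le_sigma \<sigma> x y \<longrightarrow> f x \<le> f y)"

section \<open>Function spaces and norms\<close>

definition L2_space :: "(real ^ 'd) set \<Rightarrow> (real ^ 'd \<Rightarrow> real) set" where
  "L2_space Q = {f. f \<in> borel_measurable (lebesgue_on Q) \<and> integrable (lebesgue_on Q) (\<lambda>x. (f x)\<^sup>2)}"

definition L2_norm :: "(real ^ 'd) set \<Rightarrow> (real ^ 'd \<Rightarrow> real) \<Rightarrow> real" where
  "L2_norm Q f = sqrt (\<integral>x. (f x)\<^sup>2 \<partial>lebesgue_on Q)"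

definition Linf_norm :: "(real ^ 'd) set \<Rightarrow> (real ^ 'd \<Rightarrow> real) \<Rightarrow> ereal" where
  "Linf_norm Q f = esssup (lebesgue_on Q) (\<lambda>x. ereal \<bar>f x\<bar>)"

definition Linf_space :: "(real ^ 'd) set \<Rightarrow> (real ^ 'd \<Rightarrow> real) set" where
  "Linf_space Q = {f. f \<in> borel_measurable (lebesgue_on Q) \<and> Linf_norm Q f < \<infinity>}"

definition ess_sup :: "(real ^ 'd) set \<Rightarrow> (real ^ 'd \<Rightarrow> real) \<Rightarrow> real" where
  "ess_sup Q w = real_of_ereal (esssup (lebesgue_on Q) (\<lambda>x. ereal (w x)))"

definition ess_inf :: "(real ^ 'd) set \<Rightarrow> (real ^ 'd \<Rightarrow> real) \<Rightarrow> real" where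
  "ess_inf Q w = - ess_sup Q (\<lambda>x. - w x)"

section \<open>Monotonic projection\<close>

text \<open>The existential over \<open>N\<close> makes the condition independent of the chosen representative.\<close>

definition L2_sigma :: "int ^ 'd \<Rightarrow> (real ^ 'd) set \<Rightarrow> (real ^ 'd \<Rightarrow> real) set" where
  "L2_sigma \<sigma> Q = {f \<in> L2_space Q. \<exists>N \<in> null_sets lebesgue. sigma_monotonic \<sigma> (Q - N) f}"

text \<open>The minimizer is unique as a class; \<open>arg_min\<close> selects one representative of it.\<close>

definition p_sigma ::
  "int ^ 'd \<Rightarrow> (real ^ 'd) set \<Rightarrow> (real ^ 'd \<Rightarrow> real) \<Rightarrow> (real ^ 'd \<Rightarrow> real) \<Rightarrow> real ^ 'd \<Rightarrow> real" where
  "p_sigma \<sigma> Q w f =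
     (ARG_MIN (\<lambda>g. \<integral>x. \<bar>f x - g x\<bar>\<^sup>2 * w x \<partial>lebesgue_on Q) g. g \<in> L2_sigma \<sigma> Q)"

section \<open>Grids\<close>

text \<open>Throughout, \<open>Q = cbox a b\<close>. A family of partitions is given by \<open>m\<close> and \<open>t\<close>, where
  \<open>t i 0 < \<dots> < t i (m i)\<close> are the partition points in direction \<open>i\<close>.\<close>

definition is_partition :: "real ^ 'd \<Rightarrow> real ^ 'd \<Rightarrow> ('d \<Rightarrow> nat) \<Rightarrow> ('d \<Rightarrow> nat \<Rightarrow> real) \<Rightarrow> bool" where
  "is_partition a b m t \<longleftrightarrow>
     (\<forall>i. 1 \<le> m i \<and> t i 0 = a $ i \<and> t i (m i) = b $ i \<and> (\<forall>k\<in>{1..m i}. t i (k - 1) < t i k))"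

definition grid_of :: "('d \<Rightarrow> nat) \<Rightarrow> ('d \<Rightarrow> nat \<Rightarrow> real) \<Rightarrow> (real ^ 'd) set" where
  "grid_of m t = {x. \<forall>i. \<exists>k\<in>{1..m i}. x $ i = (t i (k - 1) + t i k) / 2}"

definition dyadic_grid :: "real ^ 'd \<Rightarrow> real ^ 'd \<Rightarrow> (real ^ 'd) set \<Rightarrow> bool" where
  "dyadic_grid a b G \<longleftrightarrow>
     (\<exists>m t. is_partition a b m t \<and> G = grid_of m t \<and>
       (\<exists>n::nat. \<forall>i. m i = 2 ^ n \<and> (\<forall>k\<in>{1..2 ^ n}. t i k - t i (k - 1) = (b $ i - a $ i) / 2 ^ n)))"

definition cell_side :: "nat \<Rightarrow> (nat \<Rightarrow> real) \<Rightarrow> nat \<Rightarrow> real set" where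
  "cell_side m t k = (if k = m then {t (k - 1)..t k} else {t (k - 1)..<t k})"

text \<open>Given \<open>a\<close>, the set of midpoints \<open>G\<close> determines the numbers \<open>m i\<close> and the partition points
  (by \<open>t i 0 = a $ i\<close> and reflection at the successive midpoints), so the following set is the set of
  cells of a single partition.\<close>

definition grid_cells :: "real ^ 'd \<Rightarrow> real ^ 'd \<Rightarrow> (real ^ 'd) set \<Rightarrow> (real ^ 'd) set set" where
  "grid_cells a b G =
     {{x. \<forall>i. x $ i \<in> cell_side (m i) (t i) (k i)} | m t k.
        is_partition a b m t \<and> G = grid_of m t \<and> (\<forall>i. k i \<in> {1..m i})}"

definition grid_constant :: "real ^ 'd \<Rightarrow> real ^ 'd \<Rightarrow> (real ^ 'd) set \<Rightarrow> (real ^ 'd \<Rightarrow> real) \<Rightarrow> bool" where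
  "grid_constant a b G f \<longleftrightarrow> (\<forall>C\<in>grid_cells a b G. \<exists>c. \<forall>x\<in>C. f x = c)"

definition dyadically_grid_constant :: "real ^ 'd \<Rightarrow> real ^ 'd \<Rightarrow> (real ^ 'd \<Rightarrow> real) \<Rightarrow> bool" where
  "dyadically_grid_constant a b f \<longleftrightarrow> (\<exists>G. dyadic_grid a b G \<and> grid_constant a b G f)"

text \<open>The version for equivalence classes.\<close>

definition dyadically_grid_constant_class :: "real ^ 'd \<Rightarrow> real ^ 'd \<Rightarrow> (real ^ 'd \<Rightarrow> real) \<Rightarrow> bool" where
  "dyadically_grid_constant_class a b w \<longleftrightarrow>
     (\<exists>w0. dyadically_grid_constant a b w0 \<and> (AE x in lebesgue_on (cbox a b). w0 x = w x))"

definition S_space :: "real ^ 'd \<Rightarrow> real ^ 'd \<Rightarrow> real set \<Rightarrow> (real ^ 'd \<Rightarrow> real) set" where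
  "S_space a b I = {f. dyadically_grid_constant a b f \<and> (\<forall>x\<in>cbox a b. f x \<in> I)}"

definition S_sigma :: "int ^ 'd \<Rightarrow> real ^ 'd \<Rightarrow> real ^ 'd \<Rightarrow> real set \<Rightarrow> (real ^ 'd \<Rightarrow> real) set" where
  "S_sigma \<sigma> a b I = {f \<in> S_space a b I. sigma_monotonic \<sigma> (cbox a b) f}"

definition Linf_closure :: "(real ^ 'd) set \<Rightarrow> (real ^ 'd \<Rightarrow> real) set \<Rightarrow> (real ^ 'd \<Rightarrow> real) set" where
  "Linf_closure Q A = {w \<in> Linf_space Q. \<forall>\<epsilon>>0. \<exists>s\<in>A. Linf_norm Q (\<lambda>x. s x - w x) < ereal \<epsilon>}"

definition S_inf_pos :: "real ^ 'd \<Rightarrow> real ^ 'd \<Rightarrow> (real ^ 'd \<Rightarrow> real) set" where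
  "S_inf_pos a b = (\<Union>c\<in>{0<..}. Linf_closure (cbox a b) (S_space a b {c..}))"

end

theory Submission
  imports Defs
begin

text \<open>
  The variational inequalities of two projections, with data \<open>(f, w)\<close> and \<open>(f', w')\<close>, add up to a
  bound for their distance in terms of \<open>f' - f\<close> and \<open>w' - w\<close>. Hence the convergence of
  \<open>p_sigma \<sigma> Q (wn n) (fn n)\<close> and the Lipschitz estimate hold for arbitrary approximations, and it only
  remains to approximate \<open>f\<close> by step functions: it is an a.e. limit of continuous functions, which are
  uniformly continuous on \<open>Q\<close>. For the density of \<open>S_sigma\<close>, averaging over the cells of a dyadic grid
  preserves monotonicity, because comparable cells are translates of each other, and is at least as
  close in \<open>L\<^sup>2\<close> as any other step function on that grid.
\<close>

section \<open>Weighted projections onto the monotone cone\<close>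

text \<open>The definition of \<open>p_sigma\<close> is a choice, so nothing is known about its
  value until a minimizer is exhibited. The existence proof works with almost everywhere limits of
  concrete functions, because the cone is described pointwise outside null sets and is visibly
  closed under such limits. In the comparison of two projections, the weights enter as the relative
  error \<open>(w - w') / w'\<close> multiplied by the square-integrable function
  \<open>p - f\<close>. So uniform closeness of the weights is what makes this term small, and the
  approximating weights are chosen with one common pair of positive bounds. For equal weights the
  term vanishes and the projection is nonexpansive in the weighted norm; the constant C is the price
  of passing to the unweighted norm. On the side of the grids, the obstacle is that cells are
  attached to a set of midpoints, through all partitions with these midpoints. Once that partition
  is known to be unique, the cells become fibres of an integer-valued index, and refinement,
  measurability and monotonicity are read off from floors.\<close>

lemma L2_spaceD:
  assumes "f \<in> L2_space Q"
  shows "f \<in> borel_measurable (lebesgue_on Q)" "integrable (lebesgue_on Q) (\<lambda>x. (f x)\<^sup>2)"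
  using assms by (auto simp: L2_space_def)

lemma integrable_weighted_L2_mult:
  assumes f: "f \<in> L2_space Q" and g: "g \<in> L2_space Q"
    and w: "w \<in> borel_measurable (lebesgue_on Q)" and wK: "AE x in lebesgue_on Q. \<bar>w x\<bar> \<le> K"
  shows "integrable (lebesgue_on Q) (\<lambda>x. f x * g x * w x)"
proof -
  note [measurable] = L2_spaceD(1)[OF f] L2_spaceD(1)[OF g] w
  have "integrable (lebesgue_on Q) (\<lambda>x. K * ((f x)\<^sup>2 + (g x)\<^sup>2))"
    using L2_spaceD(2)[OF f] L2_spaceD(2)[OF g] by auto
  then show ?thesis
  proof (rule Bochner_Integration.integrable_bound)
    have young: "\<bar>u * v\<bar> \<le> u\<^sup>2 + v\<^sup>2" for u v :: real
    proof -
      have "0 \<le> (\<bar>u\<bar> - \<bar>v\<bar>)\<^sup>2" by simp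
      then have "2 * \<bar>u * v\<bar> \<le> u\<^sup>2 + v\<^sup>2"
        by (simp add: power2_diff abs_mult mult.assoc)
      then show ?thesis
        using abs_ge_zero[of "u * v"] by linarith
    qed
    show "AE x in lebesgue_on Q. norm (f x * g x * w x) \<le> norm (K * ((f x)\<^sup>2 + (g x)\<^sup>2))"
      using wK
    proof eventually_elim
      case (elim x)
      have "\<bar>f x * g x\<bar> * \<bar>w x\<bar> \<le> ((f x)\<^sup>2 + (g x)\<^sup>2) * K"
        using young elim by (intro mult_mono) auto
      moreover have "0 \<le> K" using elim by linarith
      ultimately show ?case
        by (simp add: abs_mult mult.commute)
    qed
  qed measurable
qed

lemma integrable_L2_mult:
  assumes "f \<in> L2_space Q" "g \<in> L2_space Q"
  shows "integrable (lebesgue_on Q) (\<lambda>x. f x * g x)"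
  using integrable_weighted_L2_mult[OF assms, of "\<lambda>_. 1" 1] by simp

lemma L2_space_add:
  assumes f: "f \<in> L2_space Q" and g: "g \<in> L2_space Q"
  shows "(\<lambda>x. f x + g x) \<in> L2_space Q"
  using L2_spaceD[OF f] L2_spaceD[OF g] integrable_L2_mult[OF f g]
  by (auto simp: L2_space_def power2_sum mult.assoc)

lemma L2_space_cmult:
  assumes "f \<in> L2_space Q"
  shows "(\<lambda>x. c * f x) \<in> L2_space Q"
  using L2_spaceD[OF assms] by (auto simp: L2_space_def power_mult_distrib)

lemma L2_space_diff:
  assumes "f \<in> L2_space Q" "g \<in> L2_space Q"
  shows "(\<lambda>x. f x - g x) \<in> L2_space Q"
  using L2_space_add[OF assms(1) L2_space_cmult[OF assms(2), of "-1"]] by simp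

lemma L2_space_AE_bounded:
  assumes f: "f \<in> borel_measurable (lebesgue_on Q)" and Q: "Q \<in> lmeasurable"
    and "AE x in lebesgue_on Q. \<bar>f x\<bar> \<le> K"
  shows "f \<in> L2_space Q"
proof -
  interpret finite_measure "lebesgue_on Q"
    using Q by (rule finite_measure_lebesgue_on)
  have "AE x in lebesgue_on Q. norm ((f x)\<^sup>2) \<le> K\<^sup>2"
    using assms(3) by eventually_elim (use power_mono[of "\<bar>_\<bar>" K 2] in simp)
  then have "integrable (lebesgue_on Q) (\<lambda>x. (f x)\<^sup>2)"
    using f by (intro integrable_const_bound) auto
  with f show ?thesis
    by (simp add: L2_space_def)
qed

lemma L2_norm_nonneg [simp]: "0 \<le> L2_norm Q f"
  by (simp add: L2_norm_def integral_nonneg_AE)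

lemma L2_norm_less_iff:
  assumes "0 < e"
  shows "L2_norm Q f < e \<longleftrightarrow> (\<integral>x. (f x)\<^sup>2 \<partial>lebesgue_on Q) < e\<^sup>2"
  unfolding L2_norm_def using assms by (metis real_sqrt_less_iff real_sqrt_unique less_le)

text \<open>Brings an almost everywhere statement into the form in which \<open>L2_sigma\<close>
  records monotonicity, with an explicit exceptional null set.\<close>

lemma AE_lebesgue_on_null_set:
  assumes "AE x in lebesgue_on Q. P x" and Q: "Q \<in> sets lebesgue"
  obtains N where "N \<in> null_sets lebesgue" "\<And>x. x \<in> Q - N \<Longrightarrow> P x"
proof -
  have "AE x in lebesgue. x \<in> Q \<longrightarrow> P x"
    using assms by (subst (asm) AE_restrict_space_iff) auto
  then show thesis
    by (auto simp: eventually_ae_filter intro!: that)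
qed

section \<open>The monotone functions as a convex cone closed under a.e. limits\<close>

lemma L2_sigmaD:
  assumes "f \<in> L2_sigma \<sigma> Q"
  shows "f \<in> L2_space Q"
  using assms by (simp add: L2_sigma_def)

lemma zero_in_L2_sigma: "(\<lambda>_. 0) \<in> L2_sigma \<sigma> Q"
  by (auto simp: L2_sigma_def L2_space_def sigma_monotonic_def)

lemma L2_sigma_add:
  assumes "f \<in> L2_sigma \<sigma> Q" "g \<in> L2_sigma \<sigma> Q"
  shows "(\<lambda>x. f x + g x) \<in> L2_sigma \<sigma> Q"
proof -
  obtain N N' where "N \<in> null_sets lebesgue" "sigma_monotonic \<sigma> (Q - N) f"
      "N' \<in> null_sets lebesgue" "sigma_monotonic \<sigma> (Q - N') g"
    using assms by (auto simp: L2_sigma_def)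
  then have "N \<union> N' \<in> null_sets lebesgue" "sigma_monotonic \<sigma> (Q - (N \<union> N')) (\<lambda>x. f x + g x)"
    by (auto simp: sigma_monotonic_def intro!: add_mono)
  then show ?thesis
    using assms L2_space_add unfolding L2_sigma_def by blast
qed

lemma L2_sigma_cmult:
  assumes "f \<in> L2_sigma \<sigma> Q" "0 \<le> c"
  shows "(\<lambda>x. c * f x) \<in> L2_sigma \<sigma> Q"
proof -
  obtain N where "N \<in> null_sets lebesgue" "sigma_monotonic \<sigma> (Q - N) f"
    using assms by (auto simp: L2_sigma_def)
  then have "sigma_monotonic \<sigma> (Q - N) (\<lambda>x. c * f x)"
    using \<open>0 \<le> c\<close> by (auto simp: sigma_monotonic_def intro!: mult_left_mono)
  then show ?thesis
    using assms L2_space_cmult \<open>N \<in> _\<close> unfolding L2_sigma_def by blast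
qed

text \<open>The exceptional sets of the countably many \<open>g n\<close> and the set where
  convergence fails unite to a single null set; off it, the inequalities pass to the pointwise
  limit.\<close>

lemma L2_sigma_AE_limit:
  assumes g: "\<And>n. g n \<in> L2_sigma \<sigma> Q" and h: "h \<in> L2_space Q" and Q: "Q \<in> sets lebesgue"
    and lim: "AE x in lebesgue_on Q. (\<lambda>n. g n x) \<longlonglongrightarrow> h x"
  shows "h \<in> L2_sigma \<sigma> Q"
proof -
  obtain N where N: "N \<in> null_sets lebesgue" "\<And>x. x \<in> Q - N \<Longrightarrow> (\<lambda>n. g n x) \<longlonglongrightarrow> h x"
    using AE_lebesgue_on_null_set[OF lim Q] by blast
  obtain N' where N': "\<And>n::nat. N' n \<in> null_sets lebesgue" "\<And>n. sigma_monotonic \<sigma> (Q - N' n) (g n)"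
    using g unfolding L2_sigma_def by simp metis
  let ?N = "N \<union> (\<Union>n. N' n)"
  have "?N \<in> null_sets lebesgue"
    using N N' by auto
  moreover have "sigma_monotonic \<sigma> (Q - ?N) h"
    unfolding sigma_monotonic_def
  proof (intro ballI impI)
    fix x y assume xy: "x \<in> Q - ?N" "y \<in> Q - ?N" "le_sigma \<sigma> x y"
    then have "g n x \<le> g n y" for n
      using N'(2)[of n] by (auto simp: sigma_monotonic_def)
    then show "h x \<le> h y"
      using N(2)[of x] N(2)[of y] xy by (intro LIMSEQ_le[of "\<lambda>n. g n x" _ "\<lambda>n. g n y"]) auto
  qed
  ultimately show ?thesis
    using h unfolding L2_sigma_def by blast
qed

section \<open>Existence of the weighted projection\<close>

lemma AE_convergent_if_integral_summable:
  fixes g :: "nat \<Rightarrow> 'a \<Rightarrow> real"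
  assumes int: "\<And>n. integrable M (\<lambda>x. g (Suc n) x - g n x)"
    and summ: "summable (\<lambda>n. \<integral>x. \<bar>g (Suc n) x - g n x\<bar> \<partial>M)"
  shows "AE x in M. convergent (\<lambda>n. g n x)"
proof -
  have "(\<integral>\<^sup>+x. (\<Sum>n. ennreal \<bar>g (Suc n) x - g n x\<bar>) \<partial>M) = (\<Sum>n. \<integral>\<^sup>+x. ennreal \<bar>g (Suc n) x - g n x\<bar> \<partial>M)"
    using borel_measurable_integrable[OF int] by (intro nn_integral_suminf) simp
  also have "\<dots> = (\<Sum>n. ennreal (\<integral>x. \<bar>g (Suc n) x - g n x\<bar> \<partial>M))"
    using int by (intro arg_cong[where f=suminf] ext nn_integral_eq_integral integrable_abs) auto
  also have "\<dots> < \<infinity>"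
    using summ by (simp add: ennreal_suminf_neq_top less_top[symmetric])
  finally have "(\<integral>\<^sup>+x. (\<Sum>n. ennreal \<bar>g (Suc n) x - g n x\<bar>) \<partial>M) \<noteq> \<infinity>" by simp
  then have "AE x in M. (\<Sum>n. ennreal \<bar>g (Suc n) x - g n x\<bar>) \<noteq> \<infinity>"
    using borel_measurable_integrable[OF int] by (intro nn_integral_PInf_AE borel_measurable_suminf) simp_all
  then show ?thesis
  proof eventually_elim
    case (elim x)
    then have "summable (\<lambda>n. g (Suc n) x - g n x)"
      by (intro summable_norm_cancel[of "\<lambda>n. g (Suc n) x - g n x"] summable_suminf_not_top) auto
    then obtain l where "(\<lambda>n. \<Sum>i<n. g (Suc i) x - g i x) \<longlonglongrightarrow> l"
      by (auto simp: summable_def sums_def)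
    then have "(\<lambda>n. g n x - g 0 x + g 0 x) \<longlonglongrightarrow> l + g 0 x"
      unfolding sum_lessThan_telescope[of "\<lambda>i. g i x"] by (intro tendsto_intros)
    then show ?case
      by (auto simp: convergent_def)
  qed
qed

text \<open>The Hilbert space projection argument by hand: midpoints make a minimizing sequence
  Cauchy in the weighted norm, summable increments in \<open>L\<^sup>1\<close> give an a.e. limit,
  and Fatou's lemma shows that this limit attains the infimum.\<close>

lemma minimizer_exists:
  fixes f w :: "real ^ 'd \<Rightarrow> real"
  assumes Q: "Q \<in> lmeasurable" and f: "f \<in> L2_space Q"
    and w: "w \<in> borel_measurable (lebesgue_on Q)" and c: "0 < c"
    and wb: "AE x in lebesgue_on Q. c \<le> w x \<and> w x \<le> K"
  shows "\<exists>p\<in>L2_sigma \<sigma> Q. \<forall>q\<in>L2_sigma \<sigma> Q.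
    (\<integral>x. \<bar>f x - p x\<bar>\<^sup>2 * w x \<partial>lebesgue_on Q) \<le> (\<integral>x. \<bar>f x - q x\<bar>\<^sup>2 * w x \<partial>lebesgue_on Q)"
proof -
  interpret finite_measure "lebesgue_on Q"
    using Q by (rule finite_measure_lebesgue_on)
  have Qs: "Q \<in> sets lebesgue"
    using Q by auto
  define J where "J g = (\<integral>x. (f x - g x)\<^sup>2 * w x \<partial>lebesgue_on Q)" for g
  define m where "m = (INF g\<in>L2_sigma \<sigma> Q. J g)"
  have wK: "AE x in lebesgue_on Q. \<bar>w x\<bar> \<le> K"
    using wb by eventually_elim (use c in auto)
  note intw = integrable_weighted_L2_mult[OF _ _ w wK]
  have intsq: "integrable (lebesgue_on Q) (\<lambda>x. (u x)\<^sup>2 * w x)" if "u \<in> L2_space Q" for u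
    using intw[OF that that] by (simp add: power2_eq_square)
  have J0: "0 \<le> J g" for g
    unfolding J_def using wb c by (intro integral_nonneg_AE) (auto elim!: eventually_mono)
  then have bdd: "bdd_below (J ` L2_sigma \<sigma> Q)"
    by (intro bdd_belowI[of _ 0]) auto
  have mle: "m \<le> J g" if "g \<in> L2_sigma \<sigma> Q" for g
    unfolding m_def by (rule cINF_lower[OF bdd that])
  \<comment> \<open>The gap \<open>(1/4)^n\<close> is of the order of a squared distance. Its root
    \<open>(1/2)^n\<close> is summable, so the sequence itself converges a.e. and no subsequence has
    to be extracted.\<close>
  have "\<exists>g\<in>L2_sigma \<sigma> Q. J g < m + (1/4)^n" for n :: nat
    by (rule cINF_less_iff[THEN iffD1, OF _ bdd])
       (use zero_in_L2_sigma in \<open>auto simp flip: m_def\<close>)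
  then obtain g where g: "\<And>n::nat. g n \<in> L2_sigma \<sigma> Q" "\<And>n::nat. J (g n) < m + (1/4)^n"
    by metis
  note gL2 = L2_sigmaD[OF g(1)]
  note [measurable] = L2_spaceD(1)[OF f] w L2_spaceD(1)[OF gL2]
  have dL2: "(\<lambda>x. g (Suc n) x - g n x) \<in> L2_space Q" for n
    by (intro L2_space_diff gL2)
  \<comment> \<open>Parallelogram identity: the midpoint of two members stays in the cone, so its
    value is at least \<open>m\<close>, and the two gaps bound the squared distance. They give the
    factor 5/2, which is rounded up to 4.\<close>
  have par: "(\<integral>x. (g (Suc n) x - g n x)\<^sup>2 * w x \<partial>lebesgue_on Q) \<le> 4 * (1/4)^n" for n
  proof -
    let ?h = "\<lambda>x. (1/2) * (g (Suc n) x + g n x)"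
    have h: "?h \<in> L2_sigma \<sigma> Q"
      by (intro L2_sigma_cmult L2_sigma_add g) auto
    have i: "integrable (lebesgue_on Q) (\<lambda>x. (f x - g k x)\<^sup>2 * w x)" for k
      by (intro intsq L2_space_diff f gL2)
    have "J ?h = (\<integral>x. (1/2) * ((f x - g (Suc n) x)\<^sup>2 * w x) + (1/2) * ((f x - g n x)\<^sup>2 * w x)
        - (1/4) * ((g (Suc n) x - g n x)\<^sup>2 * w x) \<partial>lebesgue_on Q)"
      unfolding J_def by (intro Bochner_Integration.integral_cong) (auto simp: power2_eq_square algebra_simps)
    also have "\<dots> = (1/2) * J (g (Suc n)) + (1/2) * J (g n)
        - (1/4) * (\<integral>x. (g (Suc n) x - g n x)\<^sup>2 * w x \<partial>lebesgue_on Q)"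
      unfolding J_def using i[of n] i[of "Suc n"] intsq[OF dL2[of n]] by simp
    finally have "(1/4) * (\<integral>x. (g (Suc n) x - g n x)\<^sup>2 * w x \<partial>lebesgue_on Q)
        = (1/2) * J (g (Suc n)) + (1/2) * J (g n) - J ?h" by simp
    moreover have "0 \<le> (1/4::real)^n" by simp
    moreover have "J (g (Suc n)) < m + (1/4) * (1/4)^n"
      using g(2)[of "Suc n"] by simp
    ultimately show ?thesis
      using mle[OF h] g(2)[of n] by linarith
  qed
  \<comment> \<open>Young's inequality with scale \<open>2^n\<close> in place of Cauchy-Schwarz: the
    quadratic term contributes \<open>2^n * (1/4)^n\<close> and the constant term
    \<open>(1/2)^n\<close> times the finite measure of \<open>Q\<close>, so that both are geometric
    with ratio 1/2.\<close>
  have L1: "(\<integral>x. \<bar>g (Suc n) x - g n x\<bar> \<partial>lebesgue_on Q) \<le> (2 / c + measure (lebesgue_on Q) Q / 2) * (1/2)^n" for n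
  proof -
    have "(\<integral>x. \<bar>g (Suc n) x - g n x\<bar> \<partial>lebesgue_on Q)
      \<le> (\<integral>x. (2^n / (2 * c)) * ((g (Suc n) x - g n x)\<^sup>2 * w x) + (1/2)^n / 2 \<partial>lebesgue_on Q)"
    proof (rule integral_mono_AE)
      show "integrable (lebesgue_on Q) (\<lambda>x. \<bar>g (Suc n) x - g n x\<bar>)"
        using integrable_L2_mult[OF dL2 L2_space_AE_bounded[OF _ Q, of "\<lambda>_. 1" 1]]
        by (intro integrable_abs) simp
      show "integrable (lebesgue_on Q) (\<lambda>x. (2^n / (2 * c)) * ((g (Suc n) x - g n x)\<^sup>2 * w x) + (1/2)^n / 2)"
        using intsq[OF dL2[of n]] by simp
      show "AE x in lebesgue_on Q. \<bar>g (Suc n) x - g n x\<bar>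
          \<le> (2^n / (2 * c)) * ((g (Suc n) x - g n x)\<^sup>2 * w x) + (1/2)^n / 2"
        using wb
      proof eventually_elim
        case (elim x)
        let ?u = "g (Suc n) x - g n x"
        have "0 \<le> (2^n * \<bar>?u\<bar> - 1)\<^sup>2 / (2 * 2^n)" by simp
        also have "\<dots> = 2^n / 2 * ?u\<^sup>2 - \<bar>?u\<bar> + (1/2)^n / 2"
          by (simp add: power2_diff power_mult_distrib field_simps power2_eq_square)
        also have "2^n / 2 * ?u\<^sup>2 = (2^n / (2 * c)) * (?u\<^sup>2 * c)"
          using c by simp
        also have "\<dots> \<le> (2^n / (2 * c)) * (?u\<^sup>2 * w x)"
          using elim c by (intro mult_left_mono) auto
        finally show ?case by linarith
      qed
    qed
    also have "\<dots> = (2^n / (2 * c)) * (\<integral>x. (g (Suc n) x - g n x)\<^sup>2 * w x \<partial>lebesgue_on Q)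
        + measure (lebesgue_on Q) Q * ((1/2)^n / 2)"
      using intsq[OF dL2[of n]] by simp
    also have "\<dots> \<le> (2^n / (2 * c)) * (4 * (1/4)^n) + measure (lebesgue_on Q) Q * ((1/2)^n / 2)"
      using c by (intro add_right_mono mult_left_mono par) auto
    also have "\<dots> = (2 / c + measure (lebesgue_on Q) Q / 2) * (1/2)^n"
    proof -
      have "(4::real)^n = 2^n * 2^n" by (simp flip: power_mult_distrib)
      then show ?thesis using c by (simp add: field_simps power_divide)
    qed
    finally show ?thesis .
  qed
  have intd: "integrable (lebesgue_on Q) (\<lambda>x. g (Suc n) x - g n x)" for n
    using integrable_L2_mult[OF dL2 L2_space_AE_bounded[OF _ Q, of "\<lambda>_. 1" 1]] by simp
  have "summable (\<lambda>n. \<integral>x. \<bar>g (Suc n) x - g n x\<bar> \<partial>lebesgue_on Q)"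
    by (rule summable_comparison_test'[OF summable_mult[OF summable_geometric]])
       (use L1 in \<open>auto\<close>)
  with intd have conv: "AE x in lebesgue_on Q. convergent (\<lambda>n. g n x)"
    by (rule AE_convergent_if_integral_summable)
  \<comment> \<open>Where the sequence diverges, \<open>lim\<close> is a default value that no a.e.
    statement sees; defining \<open>p\<close> by \<open>lim\<close> everywhere makes measurability
    immediate.\<close>
  define p where "p x = lim (\<lambda>n. g n x)" for x
  have lim: "AE x in lebesgue_on Q. (\<lambda>n. g n x) \<longlonglongrightarrow> p x"
    using conv by eventually_elim (simp add: p_def convergent_LIMSEQ_iff)
  have [measurable]: "p \<in> borel_measurable (lebesgue_on Q)"
    unfolding p_def by measurable
  \<comment> \<open>Stated for the nonnegative integral, because integrability of the limit is
    itself a consequence of this bound.\<close>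
  have fatou: "(\<integral>\<^sup>+x. ennreal ((f x - p x)\<^sup>2 * w x) \<partial>lebesgue_on Q) \<le> ennreal m"
  proof -
    have "(\<integral>\<^sup>+x. ennreal ((f x - p x)\<^sup>2 * w x) \<partial>lebesgue_on Q)
        = (\<integral>\<^sup>+x. liminf (\<lambda>n. ennreal ((f x - g n x)\<^sup>2 * w x)) \<partial>lebesgue_on Q)"
    proof (rule nn_integral_cong_AE)
      show "AE x in lebesgue_on Q. ennreal ((f x - p x)\<^sup>2 * w x) = liminf (\<lambda>n. ennreal ((f x - g n x)\<^sup>2 * w x))"
        using lim
      proof eventually_elim
        case (elim x)
        then have "(\<lambda>n. ennreal ((f x - g n x)\<^sup>2 * w x)) \<longlonglongrightarrow> ennreal ((f x - p x)\<^sup>2 * w x)"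
          by (intro tendsto_ennrealI tendsto_intros)
        then show ?case
          by (simp add: lim_imp_Liminf)
      qed
    qed
    also have "\<dots> \<le> liminf (\<lambda>n. \<integral>\<^sup>+x. ennreal ((f x - g n x)\<^sup>2 * w x) \<partial>lebesgue_on Q)"
      by (rule nn_integral_liminf) measurable
    also have "\<dots> = liminf (\<lambda>n. ennreal (J (g n)))"
    proof -
      have "(\<integral>\<^sup>+x. ennreal ((f x - g n x)\<^sup>2 * w x) \<partial>lebesgue_on Q) = ennreal (J (g n))" for n
        unfolding J_def using wb c
        by (intro nn_integral_eq_integral intsq L2_space_diff f gL2) (auto elim!: eventually_mono)
      then show ?thesis by simp
    qed
    also have "\<dots> = ennreal m"
    proof -
      have "(\<lambda>n. m + (1/4)^n) \<longlonglongrightarrow> m + 0"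
        by (intro tendsto_intros) (auto intro: LIMSEQ_power_zero)
      then have upper: "(\<lambda>n. m + (1/4)^n) \<longlonglongrightarrow> m" by simp
      have "(\<lambda>n. J (g n)) \<longlonglongrightarrow> m"
      proof (rule tendsto_sandwich[OF _ _ tendsto_const upper])
        show "\<forall>\<^sub>F n in sequentially. m \<le> J (g n)"
          using mle[OF g(1)] by simp
        show "\<forall>\<^sub>F n in sequentially. J (g n) \<le> m + (1/4)^n"
          using g(2) by (intro always_eventually allI less_imp_le)
      qed
      then have "(\<lambda>n. ennreal (J (g n))) \<longlonglongrightarrow> ennreal m"
        by (rule tendsto_ennrealI)
      then show ?thesis
        by (rule lim_imp_Liminf[OF sequentially_bot])
    qed
    finally show ?thesis .
  qed
  have nn: "AE x in lebesgue_on Q. 0 \<le> (f x - p x)\<^sup>2 * w x"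
    using wb c by (auto elim!: eventually_mono)
  have intp: "integrable (lebesgue_on Q) (\<lambda>x. (f x - p x)\<^sup>2 * w x)"
    using fatou nn by (intro integrableI_nonneg) (auto simp: top.extremum_strict le_less_trans)
  have m0: "0 \<le> m"
    unfolding m_def using J0 zero_in_L2_sigma by (intro cINF_greatest) auto
  have Jp: "J p \<le> m"
    using fatou nn_integral_eq_integral[OF intp nn] m0 by (simp add: J_def)
  \<comment> \<open>The lower bound \<open>c\<close> converts the finite weighted integral into
    square-integrability; afterwards \<open>p\<close> is recovered as
    \<open>f - (f - p)\<close>.\<close>
  have "(\<lambda>x. f x - p x) \<in> L2_space Q"
  proof -
    have "integrable (lebesgue_on Q) (\<lambda>x. (f x - p x)\<^sup>2)"
    proof (rule Bochner_Integration.integrable_bound)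
      show "integrable (lebesgue_on Q) (\<lambda>x. (1/c) * ((f x - p x)\<^sup>2 * w x))"
        using intp by simp
      show "AE x in lebesgue_on Q. norm ((f x - p x)\<^sup>2) \<le> norm ((1/c) * ((f x - p x)\<^sup>2 * w x))"
        using wb
      proof eventually_elim
        case (elim x)
        have "(f x - p x)\<^sup>2 * c \<le> (f x - p x)\<^sup>2 * w x"
          using elim by (intro mult_left_mono) auto
        then show ?case
          using c elim by (simp add: abs_mult field_simps)
      qed
    qed measurable
    then show ?thesis by (simp add: L2_space_def)
  qed
  from L2_space_diff[OF f this] have "p \<in> L2_space Q" by simp
  then have "p \<in> L2_sigma \<sigma> Q"
    using L2_sigma_AE_limit[OF g(1) _ Qs lim] by blast
  moreover have "J p \<le> J q" if "q \<in> L2_sigma \<sigma> Q" for q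
    using Jp mle[OF that] by simp
  ultimately show ?thesis
    unfolding J_def by auto
qed

section \<open>Bounded weights, variational inequality and stability\<close>

lemma L2_space_bounded_mult:
  assumes f: "f \<in> L2_space Q" and h: "h \<in> borel_measurable (lebesgue_on Q)"
    and hK: "AE x in lebesgue_on Q. \<bar>h x\<bar> \<le> K"
  shows "(\<lambda>x. f x * h x) \<in> L2_space Q"
proof -
  have "AE x in lebesgue_on Q. \<bar>(h x)\<^sup>2\<bar> \<le> K\<^sup>2"
    using hK by eventually_elim (use power_mono[of "\<bar>_\<bar>" K 2] in simp)
  then have "integrable (lebesgue_on Q) (\<lambda>x. f x * f x * (h x)\<^sup>2)"
    using h by (intro integrable_weighted_L2_mult f) auto
  then show ?thesis
    using h L2_spaceD(1)[OF f] by (auto simp: L2_space_def power2_eq_square ac_simps)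
qed

text \<open>The bounds are arguments, so that a whole sequence of weights can share them and the
  essential bounds can be inserted at the end.\<close>

definition weight :: "(real ^ 'd) set \<Rightarrow> (real ^ 'd \<Rightarrow> real) \<Rightarrow> real \<Rightarrow> real \<Rightarrow> bool" where
  "weight Q w c K \<longleftrightarrow> w \<in> borel_measurable (lebesgue_on Q) \<and> 0 < c \<and>
     (AE x in lebesgue_on Q. c \<le> w x \<and> w x \<le> K)"

lemma weightD:
  assumes "weight Q w c K"
  shows "w \<in> borel_measurable (lebesgue_on Q)" "0 < c"
    "AE x in lebesgue_on Q. c \<le> w x \<and> w x \<le> K" "AE x in lebesgue_on Q. \<bar>w x\<bar> \<le> K"
proof -
  show w: "AE x in lebesgue_on Q. c \<le> w x \<and> w x \<le> K" and "0 < c"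
      "w \<in> borel_measurable (lebesgue_on Q)"
    using assms by (auto simp: weight_def)
  show "AE x in lebesgue_on Q. \<bar>w x\<bar> \<le> K"
    using w by eventually_elim (use \<open>0 < c\<close> in auto)
qed

lemma integrable_weight_mult:
  assumes "weight Q w c K" "f \<in> L2_space Q" "g \<in> L2_space Q"
  shows "integrable (lebesgue_on Q) (\<lambda>x. f x * g x * w x)"
  using assms weightD[OF assms(1)] by (intro integrable_weighted_L2_mult)

lemma integrable_weight_square:
  assumes "weight Q w c K" "f \<in> L2_space Q"
  shows "integrable (lebesgue_on Q) (\<lambda>x. (f x)\<^sup>2 * w x)"
  using integrable_weight_mult[OF assms assms(2)] by (simp add: power2_eq_square)

text \<open>\<open>ARG_MIN\<close> picks an element satisfying \<open>is_arg_min\<close> as soon as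
  there is one; existence therefore transfers the minimizing property to the chosen
  representative.\<close>

lemma p_sigma_minimizer:
  assumes Q: "Q \<in> lmeasurable" and f: "f \<in> L2_space Q" and w: "weight Q w c K"
  shows "p_sigma \<sigma> Q w f \<in> L2_sigma \<sigma> Q"
    and "q \<in> L2_sigma \<sigma> Q \<Longrightarrow> (\<integral>x. (f x - p_sigma \<sigma> Q w f x)\<^sup>2 * w x \<partial>lebesgue_on Q)
      \<le> (\<integral>x. (f x - q x)\<^sup>2 * w x \<partial>lebesgue_on Q)"
proof -
  let ?J = "\<lambda>g. \<integral>x. \<bar>f x - g x\<bar>\<^sup>2 * w x \<partial>lebesgue_on Q"
  obtain p where "p \<in> L2_sigma \<sigma> Q" "\<forall>q\<in>L2_sigma \<sigma> Q. ?J p \<le> ?J q"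
    using minimizer_exists[OF Q f weightD(1,2,3)[OF w]] by blast
  then have "is_arg_min ?J (\<lambda>g. g \<in> L2_sigma \<sigma> Q) p"
    by (auto simp: is_arg_min_linorder)
  then have "is_arg_min ?J (\<lambda>g. g \<in> L2_sigma \<sigma> Q) (p_sigma \<sigma> Q w f)"
    unfolding p_sigma_def arg_min_def by (rule someI[where P="is_arg_min ?J (\<lambda>g. g \<in> L2_sigma \<sigma> Q)"])
  then show "p_sigma \<sigma> Q w f \<in> L2_sigma \<sigma> Q"
    and "q \<in> L2_sigma \<sigma> Q \<Longrightarrow> (\<integral>x. (f x - p_sigma \<sigma> Q w f x)\<^sup>2 * w x \<partial>lebesgue_on Q)
      \<le> (\<integral>x. (f x - q x)\<^sup>2 * w x \<partial>lebesgue_on Q)"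
    by (auto simp: is_arg_min_linorder)
qed

text \<open>First-order condition: along the segment from \<open>p\<close> to \<open>q\<close>,
  which lies in the convex cone, the objective is a quadratic polynomial in \<open>t\<close> with
  slope \<open>- 2 * B\<close> at 0, and this slope cannot be negative.\<close>

lemma p_sigma_variational:
  assumes Q: "Q \<in> lmeasurable" and f: "f \<in> L2_space Q" and w: "weight Q w c K"
    and q: "q \<in> L2_sigma \<sigma> Q"
  shows "(\<integral>x. (f x - p_sigma \<sigma> Q w f x) * (q x - p_sigma \<sigma> Q w f x) * w x \<partial>lebesgue_on Q) \<le> 0"
proof -
  define p where "p = p_sigma \<sigma> Q w f"
  have p: "p \<in> L2_sigma \<sigma> Q"
    using p_sigma_minimizer(1)[OF Q f w] by (simp add: p_def)
  have fp: "(\<lambda>x. f x - p x) \<in> L2_space Q" and qp: "(\<lambda>x. q x - p x) \<in> L2_space Q"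
    using L2_space_diff f L2_sigmaD[OF p] L2_sigmaD[OF q] by blast+
  define A where "A = (\<integral>x. (q x - p x)\<^sup>2 * w x \<partial>lebesgue_on Q)"
  define B where "B = (\<integral>x. (f x - p x) * (q x - p x) * w x \<partial>lebesgue_on Q)"
  note int = integrable_weight_square[OF w fp] integrable_weight_square[OF w qp]
    integrable_weight_mult[OF w fp qp]
  have le: "2 * B \<le> t * A" if t: "0 < t" "t \<le> 1" for t
  proof -
    let ?g = "\<lambda>x. (1 - t) * p x + t * q x"
    have "?g \<in> L2_sigma \<sigma> Q"
      using t by (intro L2_sigma_add L2_sigma_cmult p q) auto
    then have "(\<integral>x. (f x - p x)\<^sup>2 * w x \<partial>lebesgue_on Q) \<le> (\<integral>x. (f x - ?g x)\<^sup>2 * w x \<partial>lebesgue_on Q)"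
      using p_sigma_minimizer(2)[OF Q f w] unfolding p_def by blast
    also have "\<dots> = (\<integral>x. (f x - p x)\<^sup>2 * w x - 2 * t * ((f x - p x) * (q x - p x) * w x)
        + t\<^sup>2 * ((q x - p x)\<^sup>2 * w x) \<partial>lebesgue_on Q)"
      by (intro Bochner_Integration.integral_cong) (auto simp: power2_eq_square algebra_simps)
    also have "\<dots> = (\<integral>x. (f x - p x)\<^sup>2 * w x \<partial>lebesgue_on Q) - 2 * t * B + t\<^sup>2 * A"
      unfolding A_def B_def using int by simp
    finally have "t * (2 * B) \<le> t * (t * A)"
      by (simp add: power2_eq_square)
    then show ?thesis
      using t by simp
  qed
  \<comment> \<open>Only parameters in (0, 1] keep the combination in the cone, hence the one-sided
    limit.\<close>
  have "((\<lambda>t. t * A) \<longlongrightarrow> 0 * A) (at_right 0)"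
    by (intro tendsto_intros)
  moreover have "\<forall>\<^sub>F t in at_right 0. 2 * B \<le> t * A"
    using le eventually_at_right_field[of "\<lambda>t. 2 * B \<le> t * A" 0] by (metis less_le zero_less_one)
  ultimately have "2 * B \<le> 0 * A"
    by (rule tendsto_lowerbound) simp
  then show ?thesis
    by (simp add: B_def p_def)
qed

text \<open>Adding the two variational inequalities bounds \<open>\<integral> (q - p)\<^sup>2 w'\<close> by \<open>\<integral> (q - p) r w'\<close>,
  and Young's inequality absorbs the factor \<open>q - p\<close>.\<close>

lemma p_sigma_stability:
  fixes \<sigma> :: "int ^ 'd"
  assumes Q: "Q \<in> lmeasurable" and f: "f \<in> L2_space Q" and f': "f' \<in> L2_space Q"
    and w: "weight Q w c K" and w': "weight Q w' c' K'"
  defines "p \<equiv> p_sigma \<sigma> Q w f" and "q \<equiv> p_sigma \<sigma> Q w' f'"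
  defines "r \<equiv> \<lambda>x. (p x - f x) * ((w x - w' x) / w' x) + (f' x - f x)"
  shows "r \<in> L2_space Q"
    and "(\<integral>x. (q x - p x)\<^sup>2 * w' x \<partial>lebesgue_on Q) \<le> (\<integral>x. (r x)\<^sup>2 * w' x \<partial>lebesgue_on Q)"
proof -
  note [measurable] = weightD(1)[OF w] weightD(1)[OF w']
  have p: "p \<in> L2_sigma \<sigma> Q" and q: "q \<in> L2_sigma \<sigma> Q"
    using p_sigma_minimizer(1) Q f f' w w' unfolding p_def q_def by blast+
  note L2 = f f' L2_sigmaD[OF p] L2_sigmaD[OF q] L2_space_diff
  have "AE x in lebesgue_on Q. \<bar>(w x - w' x) / w' x\<bar> \<le> (K + K') / c'"
    using weightD(3)[OF w] weightD(3)[OF w']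
  proof eventually_elim
    case (elim x)
    then have "\<bar>w x - w' x\<bar> \<le> K + K'" "0 < w' x" "c' \<le> w' x"
      using weightD(2)[OF w] weightD(2)[OF w'] by auto
    then show ?case
      using weightD(2)[OF w'] by (simp add: frac_le)
  qed
  then show r: "r \<in> L2_space Q"
    unfolding r_def by (intro L2_space_add L2_space_bounded_mult L2) measurable
  have var: "(\<integral>x. (f x - p x) * (q x - p x) * w x \<partial>lebesgue_on Q) \<le> 0"
      "(\<integral>x. (f' x - q x) * (p x - q x) * w' x \<partial>lebesgue_on Q) \<le> 0"
    using p_sigma_variational[OF Q f w q] p_sigma_variational[OF Q f' w' p] by (simp_all add: p_def q_def)
  have fp: "(\<lambda>x. f x - p x) \<in> L2_space Q" and qp: "(\<lambda>x. q x - p x) \<in> L2_space Q"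
    and fq: "(\<lambda>x. f' x - q x) \<in> L2_space Q" and pq: "(\<lambda>x. p x - q x) \<in> L2_space Q"
    by (intro L2)+
  note int = integrable_weight_mult[OF w fp qp] integrable_weight_mult[OF w' fq pq]
    integrable_weight_square[OF w' qp] integrable_weight_square[OF w' r]
  \<comment> \<open>Origin of \<open>r\<close>: on the right,
    \<open>w' x * (q x - p x)\<^sup>2\<close> splits off when \<open>f' x - q x\<close> is written
    as \<open>(f' x - p x) - (q x - p x)\<close>. What remains is \<open>- (q x - p x)\<close> times
    \<open>(p x - f x) * w x + (f' x - p x) * w' x\<close>, and this last expression is
    \<open>r x * w' x\<close>.\<close>
  have "(\<integral>x. (1/2) * ((q x - p x)\<^sup>2 * w' x) - (1/2) * ((r x)\<^sup>2 * w' x) \<partial>lebesgue_on Q)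
    \<le> (\<integral>x. (f x - p x) * (q x - p x) * w x + (f' x - q x) * (p x - q x) * w' x \<partial>lebesgue_on Q)"
  proof (rule integral_mono_AE)
    show "AE x in lebesgue_on Q. (1/2) * ((q x - p x)\<^sup>2 * w' x) - (1/2) * ((r x)\<^sup>2 * w' x)
        \<le> (f x - p x) * (q x - p x) * w x + (f' x - q x) * (p x - q x) * w' x"
      using weightD(3)[OF w']
    proof eventually_elim
      case (elim x)
      then have pos: "0 < w' x"
        using weightD(2)[OF w'] by auto
      have rw: "r x * w' x = (p x - f x) * (w x - w' x) + (f' x - f x) * w' x"
        using pos by (simp add: r_def field_simps)
      have "0 \<le> (q x - p x - r x)\<^sup>2 * w' x"
        using pos by simp
      also have "\<dots> = (q x - p x)\<^sup>2 * w' x + (r x)\<^sup>2 * w' x - 2 * (q x - p x) * (r x * w' x)"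
        by (simp add: power2_eq_square algebra_simps)
      finally show ?case
        unfolding rw by (simp add: power2_eq_square algebra_simps)
    qed
  qed (use int in auto)
  also have "\<dots> \<le> 0"
    using var int by simp
  finally show "(\<integral>x. (q x - p x)\<^sup>2 * w' x \<partial>lebesgue_on Q) \<le> (\<integral>x. (r x)\<^sup>2 * w' x \<partial>lebesgue_on Q)"
    using int by simp
qed

lemma weighted_L2_norm_bounds:
  assumes w: "weight Q w c K" and f: "f \<in> L2_space Q"
  shows "c * (L2_norm Q f)\<^sup>2 \<le> (\<integral>x. (f x)\<^sup>2 * w x \<partial>lebesgue_on Q)"
    and "(\<integral>x. (f x)\<^sup>2 * w x \<partial>lebesgue_on Q) \<le> K * (L2_norm Q f)\<^sup>2"
proof -
  have N: "(L2_norm Q f)\<^sup>2 = (\<integral>x. (f x)\<^sup>2 \<partial>lebesgue_on Q)"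
    by (simp add: L2_norm_def)
  note int = L2_spaceD(2)[OF f] integrable_weight_square[OF w f]
  have "(\<integral>x. c * (f x)\<^sup>2 \<partial>lebesgue_on Q) \<le> (\<integral>x. (f x)\<^sup>2 * w x \<partial>lebesgue_on Q)"
  proof (rule integral_mono_AE)
    show "AE x in lebesgue_on Q. c * (f x)\<^sup>2 \<le> (f x)\<^sup>2 * w x"
      using weightD(3)[OF w] by eventually_elim (simp add: mult.commute[of c] mult_left_mono)
  qed (use int in auto)
  then show "c * (L2_norm Q f)\<^sup>2 \<le> (\<integral>x. (f x)\<^sup>2 * w x \<partial>lebesgue_on Q)"
    by (simp add: N)
  have "(\<integral>x. (f x)\<^sup>2 * w x \<partial>lebesgue_on Q) \<le> (\<integral>x. K * (f x)\<^sup>2 \<partial>lebesgue_on Q)"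
  proof (rule integral_mono_AE)
    show "AE x in lebesgue_on Q. (f x)\<^sup>2 * w x \<le> K * (f x)\<^sup>2"
      using weightD(3)[OF w] by eventually_elim (simp add: mult.commute[of K] mult_left_mono)
  qed (use int in auto)
  then show "(\<integral>x. (f x)\<^sup>2 * w x \<partial>lebesgue_on Q) \<le> K * (L2_norm Q f)\<^sup>2"
    by (simp add: N)
qed

text \<open>With equal weights the function \<open>r\<close> of the stability estimate is just
  \<open>f' - f\<close>, so the projection is nonexpansive in the weighted norm. Comparing that norm
  with the unweighted one costs \<open>K\<close> on the right and \<open>c\<close> on the left,
  before taking roots.\<close>

lemma p_sigma_lipschitz:
  assumes Q: "Q \<in> lmeasurable" and f: "f \<in> L2_space Q" and f': "f' \<in> L2_space Q"
    and w: "weight Q w c K"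
  shows "L2_norm Q (\<lambda>x. p_sigma \<sigma> Q w f' x - p_sigma \<sigma> Q w f x)
    \<le> sqrt (K / c) * L2_norm Q (\<lambda>x. f' x - f x)"
proof -
  let ?p = "p_sigma \<sigma> Q w f" and ?q = "p_sigma \<sigma> Q w f'"
  have qp: "(\<lambda>x. ?q x - ?p x) \<in> L2_space Q"
    using p_sigma_minimizer(1)[OF Q _ w] f f' by (intro L2_space_diff L2_sigmaD)
  have "c * (L2_norm Q (\<lambda>x. ?q x - ?p x))\<^sup>2 \<le> (\<integral>x. (?q x - ?p x)\<^sup>2 * w x \<partial>lebesgue_on Q)"
    by (rule weighted_L2_norm_bounds[OF w qp])
  also have "\<dots> \<le> (\<integral>x. (f' x - f x)\<^sup>2 * w x \<partial>lebesgue_on Q)"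
    using p_sigma_stability(2)[OF Q f f' w w] by simp
  also have "\<dots> \<le> K * (L2_norm Q (\<lambda>x. f' x - f x))\<^sup>2"
    by (rule weighted_L2_norm_bounds[OF w L2_space_diff[OF f' f]])
  finally have "(L2_norm Q (\<lambda>x. ?q x - ?p x))\<^sup>2 \<le> (K / c) * (L2_norm Q (\<lambda>x. f' x - f x))\<^sup>2"
    using weightD(2)[OF w] by (simp add: field_simps)
  then have "sqrt ((L2_norm Q (\<lambda>x. ?q x - ?p x))\<^sup>2) \<le> sqrt ((K / c) * (L2_norm Q (\<lambda>x. f' x - f x))\<^sup>2)"
    by (rule real_sqrt_le_mono)
  then show ?thesis
    unfolding real_sqrt_mult by simp
qed

lemma power2_sum_le: "(u + v)\<^sup>2 \<le> 2 * u\<^sup>2 + 2 * v\<^sup>2" for u v :: real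
  using zero_le_power2[of "u - v"] unfolding power2_diff power2_sum by linarith

text \<open>Separates the weight error from the data error: the relative weight error is at most
  \<open>e / c\<close>, and the factor 2 comes from squaring a sum. The bounds \<open>c\<close> and
  \<open>K\<close> are those of the perturbed weight, while
  \<open>p_sigma \<sigma> Q w f - f\<close> belongs to the limit problem; hence the estimate is
  uniform along a sequence of weights with common bounds.\<close>

lemma p_sigma_continuity:
  assumes Q: "Q \<in> lmeasurable" and f: "f \<in> L2_space Q" and f': "f' \<in> L2_space Q"
    and w: "weight Q w c\<^sub>0 K\<^sub>0" and w': "weight Q w' c K"
    and e: "AE x in lebesgue_on Q. \<bar>w' x - w x\<bar> \<le> e"
  shows "(L2_norm Q (\<lambda>x. p_sigma \<sigma> Q w' f' x - p_sigma \<sigma> Q w f x))\<^sup>2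
    \<le> 2 * K / c * ((e / c)\<^sup>2 * (L2_norm Q (\<lambda>x. p_sigma \<sigma> Q w f x - f x))\<^sup>2 + (L2_norm Q (\<lambda>x. f' x - f x))\<^sup>2)"
proof -
  let ?p = "p_sigma \<sigma> Q w f" and ?q = "p_sigma \<sigma> Q w' f'"
  let ?r = "\<lambda>x. (?p x - f x) * ((w x - w' x) / w' x) + (f' x - f x)"
  have c: "0 < c"
    using weightD(2)[OF w'] .
  have qp: "(\<lambda>x. ?q x - ?p x) \<in> L2_space Q" and pf: "(\<lambda>x. ?p x - f x) \<in> L2_space Q"
    using p_sigma_minimizer(1)[OF Q f w] p_sigma_minimizer(1)[OF Q f' w'] f
    by (auto intro!: L2_space_diff intro: L2_sigmaD)
  have int: "integrable (lebesgue_on Q) (\<lambda>x. (?r x)\<^sup>2)" "integrable (lebesgue_on Q) (\<lambda>x. (?p x - f x)\<^sup>2)"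
      "integrable (lebesgue_on Q) (\<lambda>x. (f' x - f x)\<^sup>2)"
    using L2_spaceD(2) p_sigma_stability(1)[OF Q f f' w w'] pf L2_space_diff[OF f' f] by blast+
  have "c * (L2_norm Q (\<lambda>x. ?q x - ?p x))\<^sup>2 \<le> (\<integral>x. (?q x - ?p x)\<^sup>2 * w' x \<partial>lebesgue_on Q)"
    by (rule weighted_L2_norm_bounds[OF w' qp])
  also have "\<dots> \<le> (\<integral>x. (?r x)\<^sup>2 * w' x \<partial>lebesgue_on Q)"
    by (rule p_sigma_stability(2)[OF Q f f' w w'])
  also have "\<dots> \<le> (\<integral>x. K * (2 * (e / c)\<^sup>2 * (?p x - f x)\<^sup>2 + 2 * (f' x - f x)\<^sup>2) \<partial>lebesgue_on Q)"
  proof (rule integral_mono_AE)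
    show "AE x in lebesgue_on Q. (?r x)\<^sup>2 * w' x \<le> K * (2 * (e / c)\<^sup>2 * (?p x - f x)\<^sup>2 + 2 * (f' x - f x)\<^sup>2)"
      using e weightD(3)[OF w']
    proof eventually_elim
      case (elim x)
      let ?u = "(?p x - f x) * ((w x - w' x) / w' x)" and ?v = "f' x - f x"
      have "\<bar>(w x - w' x) / w' x\<bar> \<le> e / c"
        using elim c by (simp add: frac_le abs_minus_commute)
      from power_mono[OF this, of 2] have "((w x - w' x) / w' x)\<^sup>2 \<le> (e / c)\<^sup>2"
        by (simp only: power2_abs)
      then have u: "?u\<^sup>2 \<le> (e / c)\<^sup>2 * (?p x - f x)\<^sup>2"
        unfolding power_mult_distrib by (subst mult.commute) (intro mult_right_mono, auto)
      have "(?u + ?v)\<^sup>2 \<le> 2 * ?u\<^sup>2 + 2 * ?v\<^sup>2"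
        by (rule power2_sum_le)
      also have "\<dots> \<le> 2 * (e / c)\<^sup>2 * (?p x - f x)\<^sup>2 + 2 * ?v\<^sup>2"
        using u by simp
      finally have "(?r x)\<^sup>2 * w' x \<le> (2 * (e / c)\<^sup>2 * (?p x - f x)\<^sup>2 + 2 * ?v\<^sup>2) * K"
        using elim c by (intro mult_mono) auto
      then show ?case by (simp add: mult.commute)
    qed
  qed (use int integrable_weight_square[OF w' p_sigma_stability(1)[OF Q f f' w w']] in auto)
  also have "\<dots> = 2 * K * ((e / c)\<^sup>2 * (L2_norm Q (\<lambda>x. ?p x - f x))\<^sup>2 + (L2_norm Q (\<lambda>x. f' x - f x))\<^sup>2)"
    using int by (simp add: L2_norm_def algebra_simps)
  finally show ?thesis
    using c by (simp add: field_simps)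
qed

lemma p_sigma_tendsto:
  assumes Q: "Q \<in> lmeasurable" and f: "f \<in> L2_space Q" and fn: "\<And>n. fn n \<in> L2_space Q"
    and w: "weight Q w c\<^sub>0 K\<^sub>0" and wn: "\<And>n. weight Q (wn n) c K"
    and e: "\<And>n. AE x in lebesgue_on Q. \<bar>wn n x - w x\<bar> \<le> e n" "e \<longlonglongrightarrow> 0"
    and lim: "(\<lambda>n. L2_norm Q (\<lambda>x. fn n x - f x)) \<longlonglongrightarrow> 0"
  shows "(\<lambda>n. L2_norm Q (\<lambda>x. p_sigma \<sigma> Q (wn n) (fn n) x - p_sigma \<sigma> Q w f x)) \<longlonglongrightarrow> 0"
proof -
  let ?d = "\<lambda>n. L2_norm Q (\<lambda>x. p_sigma \<sigma> Q (wn n) (fn n) x - p_sigma \<sigma> Q w f x)"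
  let ?P = "L2_norm Q (\<lambda>x. p_sigma \<sigma> Q w f x - f x)"
  let ?R = "\<lambda>n. 2 * K / c * ((e n / c)\<^sup>2 * ?P\<^sup>2 + (L2_norm Q (\<lambda>x. fn n x - f x))\<^sup>2)"
  have c: "c \<noteq> 0"
    using weightD(2)[OF wn] by simp
  have "?R \<longlonglongrightarrow> 2 * K / c * ((0 / c)\<^sup>2 * ?P\<^sup>2 + 0\<^sup>2)"
    using c by (intro tendsto_intros e(2) lim) auto
  then have R: "?R \<longlonglongrightarrow> 0" by simp
  have "(\<lambda>n. (?d n)\<^sup>2) \<longlonglongrightarrow> 0"
  proof (rule tendsto_sandwich[OF _ _ tendsto_const R])
    show "\<forall>\<^sub>F n in sequentially. (?d n)\<^sup>2 \<le> ?R n"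
      by (intro always_eventually allI p_sigma_continuity[OF Q f fn w wn e(1)])
  qed simp
  then have "(\<lambda>n. sqrt ((?d n)\<^sup>2)) \<longlonglongrightarrow> sqrt 0"
    by (rule tendsto_real_sqrt)
  then show ?thesis by simp
qed

section \<open>Dyadic grids\<close>

lemma increasing_below:
  fixes t :: "nat \<Rightarrow> real"
  assumes "\<And>k. k < m \<Longrightarrow> t k < t (Suc k)" and "i < j" "j \<le> m"
  shows "t i < t j"
  using \<open>i < j\<close> \<open>j \<le> m\<close>
proof (induction j)
  case (Suc j)
  then have "t j < t (Suc j)" "i = j \<or> t i < t j"
    using assms(1)[of j] by (auto simp: less_Suc_eq)
  then show ?case by auto
qed simp

text \<open>The \<open>k\<close>-th midpoint of \<open>t\<close> is the \<open>j\<close>-th midpoint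
  of \<open>t'\<close> for some \<open>j\<close>. An interval with \<open>j < k\<close> lies to the
  left of \<open>t' k = t k\<close> and cannot contain it, so \<open>j \<ge> k\<close> and the
  \<open>k\<close>-th midpoint of \<open>t'\<close> is at most that of \<open>t\<close>. As the left
  endpoints agree, the right ones are ordered in the same way.\<close>

lemma midpoint_le_if_agree:
  fixes t t' :: "nat \<Rightarrow> real"
  assumes inc: "\<And>k. k < m \<Longrightarrow> t k < t (Suc k)" and inc': "\<And>k. k < m' \<Longrightarrow> t' k < t' (Suc k)"
    and sub: "(\<lambda>k. (t k + t (Suc k)) / 2) ` {..<m} \<subseteq> (\<lambda>k. (t' k + t' (Suc k)) / 2) ` {..<m'}"
    and k: "k < m" "k < m'" "t k = t' k"
  shows "t' (Suc k) \<le> t (Suc k)"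
proof -
  obtain j where j: "j < m'" "t k + t (Suc k) = t' j + t' (Suc j)"
    using sub k(1) by force
  have "\<not> j < k"
  proof
    assume "j < k"
    then have "t' (Suc j) \<le> t' k"
      using increasing_below[where t=t' and m=m' and i="Suc j" and j=k, OF inc'] k(2) by (cases "Suc j = k") auto
    then show False
      using inc[OF k(1)] inc'[OF j(1)] j(2) k(3) by linarith
  qed
  then have "k = j \<or> k < j" by auto
  then have "t' k \<le> t' j" "t' (Suc k) \<le> t' (Suc j)"
    using increasing_below[where t=t' and m=m', OF inc', of k j]
      increasing_below[where t=t' and m=m', OF inc', of "Suc k" "Suc j"] j(1) by auto
  then show ?thesis
    using j(2) k(3) by linarith
qed

text \<open>Starting from the common left end, each point is forced by applying the one-sided
  comparison in both directions. If one partition were shorter, its last point would be a non-final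
  point of the other, although both end at the same number.\<close>

lemma midpoints_determine_partition:
  fixes t t' :: "nat \<Rightarrow> real"
  assumes inc: "\<And>k. k < m \<Longrightarrow> t k < t (Suc k)" and inc': "\<And>k. k < m' \<Longrightarrow> t' k < t' (Suc k)"
    and ends: "t 0 = t' 0" "t m = t' m'"
    and eq: "(\<lambda>k. (t k + t (Suc k)) / 2) ` {..<m} = (\<lambda>k. (t' k + t' (Suc k)) / 2) ` {..<m'}"
  shows "m = m'" and "k \<le> m \<Longrightarrow> t k = t' k"
proof -
  have agree: "k \<le> m \<Longrightarrow> k \<le> m' \<Longrightarrow> t k = t' k" for k
  proof (induction k)
    case (Suc k)
    then show ?case
      using midpoint_le_if_agree[where t=t and t'=t' and m=m and m'=m' and k=k, OF inc inc']
        midpoint_le_if_agree[where t=t' and t'=t and m=m' and m'=m and k=k, OF inc' inc] eq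
      by (intro antisym) auto
  qed (use ends in simp)
  have "\<not> m < m'" "\<not> m' < m"
    using agree[of m] agree[of m'] ends increasing_below[where t=t' and m=m', OF inc', of m m']
      increasing_below[where t=t and m=m, OF inc, of m' m] by auto
  then show "m = m'" by simp
  then show "k \<le> m \<Longrightarrow> t k = t' k"
    using agree by simp
qed

lemma is_partition_increasing:
  assumes "is_partition a b m t" "k < m i"
  shows "t i k < t i (Suc k)"
proof -
  have "\<forall>k\<in>{1..m i}. t i (k - 1) < t i k"
    using assms(1) by (simp add: is_partition_def)
  from bspec[OF this, of "Suc k"] show ?thesis
    using assms(2) by simp
qed

lemma grid_of_iff_midpoints:
  "x \<in> grid_of m t \<longleftrightarrow> (\<forall>i. x $ i \<in> (\<lambda>k. (t i k + t i (Suc k)) / 2) ` {..<m i})"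
proof -
  have "(\<exists>k\<in>{1..M}. y = (s (k - 1) + s k) / 2) \<longleftrightarrow> y \<in> (\<lambda>k. (s k + s (Suc k)) / 2) ` {..<M}"
    for y :: real and s :: "nat \<Rightarrow> real" and M
    unfolding image_iff
  proof
    assume "\<exists>k\<in>{1..M}. y = (s (k - 1) + s k) / 2"
    then obtain k where "k \<in> {1..M}" "y = (s (k - 1) + s k) / 2" by blast
    then show "\<exists>k\<in>{..<M}. y = (s k + s (Suc k)) / 2"
      by (intro bexI[of _ "k - 1"]) auto
  next
    assume "\<exists>k\<in>{..<M}. y = (s k + s (Suc k)) / 2"
    then obtain k where "k < M" "y = (s k + s (Suc k)) / 2" by blast
    then show "\<exists>k\<in>{1..M}. y = (s (k - 1) + s k) / 2"
      by (intro bexI[of _ "Suc k"]) auto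
  qed
  then show ?thesis
    by (simp add: grid_of_def)
qed

lemma grid_determines_midpoints:
  assumes p: "is_partition a b m t" and eq: "grid_of m t = grid_of m' t'"
  shows "(\<lambda>k. (t i k + t i (Suc k)) / 2) ` {..<m i} \<subseteq> (\<lambda>k. (t' i k + t' i (Suc k)) / 2) ` {..<m' i}"
proof
  fix s assume s: "s \<in> (\<lambda>k. (t i k + t i (Suc k)) / 2) ` {..<m i}"
  \<comment> \<open>To see a one-dimensional midpoint in the product set, the other coordinates are
    filled with first midpoints, which exist since every \<open>m j\<close> is positive.\<close>
  define x where "x = (\<chi> j. if j = i then s else (t j 0 + t j (Suc 0)) / 2)"
  have "0 < m j" for j
    using p by (auto simp: is_partition_def Suc_le_eq)
  then have "x \<in> grid_of m t"
    using s unfolding grid_of_iff_midpoints by (auto simp: x_def)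
  then have "x $ i \<in> (\<lambda>k. (t' i k + t' i (Suc k)) / 2) ` {..<m' i}"
    unfolding eq grid_of_iff_midpoints by blast
  then show "s \<in> (\<lambda>k. (t' i k + t' i (Suc k)) / 2) ` {..<m' i}"
    by (simp add: x_def)
qed

text \<open>\<open>grid_cells\<close> ranges over every partition with the given midpoints; by this
  uniqueness an arbitrary one of them can be replaced by the dyadic one.\<close>

lemma grid_determines_partition:
  assumes p: "is_partition a b m t" and p': "is_partition a b m' t'" and eq: "grid_of m t = grid_of m' t'"
  shows "m = m'" and "k \<le> m i \<Longrightarrow> t i k = t' i k"
proof -
  have *: "m i = m' i \<and> (\<forall>k\<le>m i. t i k = t' i k)" for i
  proof -
    have ends: "t i 0 = t' i 0" "t i (m i) = t' i (m' i)"
      using p p' by (simp_all add: is_partition_def)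
    have "(\<lambda>k. (t i k + t i (Suc k)) / 2) ` {..<m i} = (\<lambda>k. (t' i k + t' i (Suc k)) / 2) ` {..<m' i}"
      using grid_determines_midpoints[OF p eq] grid_determines_midpoints[OF p' eq[symmetric]]
      by (rule subset_antisym)
    from midpoints_determine_partition[where t="t i" and t'="t' i" and m="m i" and m'="m' i",
        OF is_partition_increasing[OF p] is_partition_increasing[OF p'] ends this]
    show ?thesis by blast
  qed
  then show "m = m'" by auto
  from * show "k \<le> m i \<Longrightarrow> t i k = t' i k" by auto
qed

section \<open>Dyadic cells as fibres of an integer index\<close>

definition dyadic_point :: "real ^ 'd \<Rightarrow> real ^ 'd \<Rightarrow> nat \<Rightarrow> 'd \<Rightarrow> nat \<Rightarrow> real" where
  "dyadic_point a b n i k = a $ i + real k * ((b $ i - a $ i) / 2 ^ n)"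

lemma dyadic_point_diff:
  assumes "1 \<le> k"
  shows "dyadic_point a b n i k - dyadic_point a b n i (k - 1) = (b $ i - a $ i) / 2 ^ n"
  using assms by (cases k) (simp_all add: dyadic_point_def distrib_right add_divide_distrib)

definition std_grid :: "real ^ 'd \<Rightarrow> real ^ 'd \<Rightarrow> nat \<Rightarrow> (real ^ 'd) set" where
  "std_grid a b n = grid_of (\<lambda>_. 2 ^ n) (dyadic_point a b n)"

text \<open>The minimum assigns the right boundary face of the box to the last cell.\<close>

definition cell_index :: "real ^ 'd \<Rightarrow> real ^ 'd \<Rightarrow> nat \<Rightarrow> real ^ 'd \<Rightarrow> 'd \<Rightarrow> int" where
  "cell_index a b n x i = min \<lfloor>2 ^ n * ((x $ i - a $ i) / (b $ i - a $ i))\<rfloor> (2 ^ n - 1)"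

definition cell_indices :: "nat \<Rightarrow> ('d \<Rightarrow> int) set" where
  "cell_indices n = {\<kappa>. \<forall>i. \<kappa> i \<in> {0..2 ^ n - 1}}"

lemma finite_cell_indices: "finite (cell_indices n :: ('d::finite \<Rightarrow> int) set)"
proof -
  have "cell_indices n = PiE UNIV (\<lambda>_::'d. {0..2 ^ n - 1})"
    by (auto simp: cell_indices_def PiE_UNIV_domain)
  then show ?thesis
    by (simp add: finite_PiE)
qed

text \<open>Nestedness of the dyadic grids. Dividing by \<open>2 ^ p\<close> commutes with the
  floor, sends the cap of the finer level to that of the coarser one, and passes through
  \<open>min\<close> because it is monotone.\<close>

lemma cell_index_refine:
  "cell_index a b n x i = cell_index a b (n + p) x i div 2 ^ p"
proof -
  let ?u = "2 ^ n * ((x $ i - a $ i) / (b $ i - a $ i))"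
  have "\<lfloor>?u\<rfloor> = \<lfloor>2 ^ p * ?u / real_of_int (2 ^ p)\<rfloor>" by simp
  also have "\<dots> = \<lfloor>2 ^ p * ?u\<rfloor> div 2 ^ p"
    by (rule floor_divide_real_eq_div) simp
  finally have floor: "\<lfloor>?u\<rfloor> = \<lfloor>2 ^ (n + p) * ((x $ i - a $ i) / (b $ i - a $ i))\<rfloor> div 2 ^ p"
    by (simp add: power_add ac_simps)
  have "(2 ^ (n + p) - 1 :: int) = 2 ^ p - 1 + (2 ^ n - 1) * 2 ^ p"
    by (simp add: power_add algebra_simps)
  also have "\<dots> div 2 ^ p = 2 ^ n - 1"
    by (subst div_mult_self1) (simp_all add: div_pos_pos_trivial)
  finally have last: "(2 ^ (n + p) - 1 :: int) div 2 ^ p = 2 ^ n - 1" .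
  have mono: "u \<le> v \<Longrightarrow> u div 2 ^ p \<le> v div 2 ^ p" for u v :: int
    by (rule zdiv_mono1) auto
  have "min u v div 2 ^ p = min (u div 2 ^ p) (v div 2 ^ p)" for u v :: int
    using mono[of u v] mono[of v u] by (cases "u \<le> v") (auto simp: min_def)
  then show ?thesis
    unfolding cell_index_def by (simp only: last floor)
qed

lemma cell_index_eq_coarser:
  assumes "cell_index a b n' x = cell_index a b n' y" "n \<le> n'"
  shows "cell_index a b n x = cell_index a b n y"
proof
  obtain p where "n' = n + p" using \<open>n \<le> n'\<close> le_Suc_ex by blast
  then show "cell_index a b n x i = cell_index a b n y i" for i
    using assms(1) cell_index_refine[of a b n _ i p] by simp
qed

context
  fixes a b :: "real ^ 'd"
  assumes ab: "\<And>i. a $ i < b $ i"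
begin

lemma cell_index_in_cell_indices:
  assumes "x \<in> cbox a b"
  shows "cell_index a b n x \<in> cell_indices n"
  using assms ab by (auto simp: cell_index_def cell_indices_def mem_box_cart less_imp_le)

lemma cell_index_mono:
  assumes "x $ i \<le> y $ i"
  shows "cell_index a b n x i \<le> cell_index a b n y i"
proof -
  have "(x $ i - a $ i) / (b $ i - a $ i) \<le> (y $ i - a $ i) / (b $ i - a $ i)"
    using assms ab[of i] by (intro divide_right_mono) auto
  then have "2 ^ n * ((x $ i - a $ i) / (b $ i - a $ i)) \<le> 2 ^ n * ((y $ i - a $ i) / (b $ i - a $ i))"
    by (intro mult_left_mono) auto
  from floor_mono[OF this] show ?thesis
    unfolding cell_index_def by (intro min.mono) auto
qed

lemma is_partition_dyadic: "is_partition a b (\<lambda>_. 2 ^ n) (dyadic_point a b n)"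
  using ab unfolding is_partition_def dyadic_point_def
  by (auto simp: divide_simps intro!: mult_strict_right_mono)

lemma dyadic_grid_iff: "dyadic_grid a b G \<longleftrightarrow> (\<exists>n. G = std_grid a b n)"
proof
  assume "dyadic_grid a b G"
  then obtain m t n where p: "is_partition a b m t" "G = grid_of m t"
    and m: "\<And>i. m i = 2 ^ n"
    and step: "\<And>i k. k \<in> {1..2 ^ n} \<Longrightarrow> t i k - t i (k - 1) = (b $ i - a $ i) / 2 ^ n"
    unfolding dyadic_grid_def by blast
  \<comment> \<open>Beyond index \<open>2 ^ n\<close> the values of \<open>t\<close> are arbitrary,
    but no midpoint involves them.\<close>
  have t: "t i k = dyadic_point a b n i k" if "k \<le> 2 ^ n" for i k
    using that
  proof (induction k)
    case 0
    then show ?case using p(1) by (simp add: is_partition_def dyadic_point_def)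
  next
    case (Suc k)
    then have "t i (Suc k) = dyadic_point a b n i k + (b $ i - a $ i) / 2 ^ n"
      using step[of "Suc k" i] by simp
    then show ?case by (simp add: dyadic_point_def distrib_right add_divide_distrib)
  qed
  have "(\<lambda>k. (t i k + t i (Suc k)) / 2) ` {..<2 ^ n}
      = (\<lambda>k. (dyadic_point a b n i k + dyadic_point a b n i (Suc k)) / 2) ` {..<2 ^ n}" for i
    by (intro image_cong) (auto simp: t)
  then have "x \<in> G \<longleftrightarrow> x \<in> std_grid a b n" for x
    unfolding p std_grid_def grid_of_iff_midpoints m by simp
  then show "\<exists>n. G = std_grid a b n" by blast
next
  assume "\<exists>n. G = std_grid a b n"
  then obtain n where "G = std_grid a b n" by blast
  then show "dyadic_grid a b G"
    unfolding dyadic_grid_def using is_partition_dyadic[of n]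
    by (intro exI[of _ "\<lambda>_. 2 ^ n"] exI[of _ "dyadic_point a b n"] conjI exI[of _ n])
       (auto simp: std_grid_def dyadic_point_diff[unfolded One_nat_def])
qed

text \<open>Sides are counted from 1 and indices from 0, hence \<open>int k - 1\<close>. Measured
  from \<open>a $ i\<close> in units of the step \<open>h\<close>, the coordinate is
  \<open>u\<close> and a half-open side says that the floor of \<open>u\<close> is
  \<open>k - 1\<close>. For the closed last side, the cap in \<open>cell_index\<close> takes care of
  \<open>u = 2 ^ n\<close>.\<close>

lemma mem_cell_side_dyadic:
  assumes k: "k \<in> {1..2 ^ n}"
  shows "x $ i \<in> cell_side (2 ^ n) (dyadic_point a b n i) k \<longleftrightarrow>
    a $ i \<le> x $ i \<and> x $ i \<le> b $ i \<and> cell_index a b n x i = int k - 1"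
proof -
  define u where "u = 2 ^ n * ((x $ i - a $ i) / (b $ i - a $ i))"
  define h where "h = (b $ i - a $ i) / 2 ^ n"
  have h: "0 < h" using ab[of i] by (simp add: h_def)
  have x: "x $ i = a $ i + u * h" and b: "b $ i = a $ i + 2 ^ n * h"
    using ab[of i] by (simp_all add: u_def h_def)
  have pt: "dyadic_point a b n i j = a $ i + real j * h" for j
    by (simp add: dyadic_point_def h_def)
  have kr: "real (k - 1) = real k - 1" using k by (simp add: of_nat_diff)
  have idx: "cell_index a b n x i = min \<lfloor>u\<rfloor> (2 ^ n - 1)"
    by (simp add: cell_index_def u_def)
  have le: "a $ i \<le> x $ i \<longleftrightarrow> 0 \<le> u" "x $ i \<le> b $ i \<longleftrightarrow> u \<le> 2 ^ n"
    unfolding x b using h by (auto simp: zero_le_mult_iff)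
  have lb: "dyadic_point a b n i (k - 1) \<le> x $ i \<longleftrightarrow> real k - 1 \<le> u"
    unfolding pt x kr using h by simp
  have ub: "x $ i \<le> dyadic_point a b n i k \<longleftrightarrow> u \<le> real k" "x $ i < dyadic_point a b n i k \<longleftrightarrow> u < real k"
    unfolding pt x using h by simp_all
  show ?thesis
  proof (cases "k = 2 ^ n")
    case True
    have "min \<lfloor>u\<rfloor> (2 ^ n - 1) = 2 ^ n - 1 \<longleftrightarrow> 2 ^ n - 1 \<le> \<lfloor>u\<rfloor>"
      by (auto simp: min_def)
    also have "\<dots> \<longleftrightarrow> real k - 1 \<le> u"
      unfolding le_floor_iff using True by simp
    finally have "min \<lfloor>u\<rfloor> (2 ^ n - 1) = 2 ^ n - 1 \<longleftrightarrow> real k - 1 \<le> u" .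
    moreover have "0 \<le> u" if "2 ^ n - 1 \<le> u"
      by (rule order_trans[OF _ that]) simp
    moreover have "real k = 2 ^ n" "int k = 2 ^ n" using True by simp_all
    ultimately show ?thesis
      unfolding cell_side_def if_P[OF True] atLeastAtMost_iff lb ub idx le by auto
  next
    case False
    then have "k < 2 ^ n" using k by simp
    then have "int k < int (2 ^ n)" "real k < real (2 ^ n)"
      by (simp_all only: of_nat_less_iff)
    then have kn: "int k - 1 < 2 ^ n - 1" "real k < 2 ^ n" "1 \<le> real k"
      using k by simp_all
    have "min j M = l \<longleftrightarrow> j = l" if "l < M" for j l M :: int
      using that by auto
    from this[OF kn(1)] have "min \<lfloor>u\<rfloor> (2 ^ n - 1) = int k - 1 \<longleftrightarrow> \<lfloor>u\<rfloor> = int k - 1" .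
    also have "\<dots> \<longleftrightarrow> real k - 1 \<le> u \<and> u < real k"
      by (simp add: floor_eq_iff)
    finally have idx_iff: "min \<lfloor>u\<rfloor> (2 ^ n - 1) = int k - 1 \<longleftrightarrow> real k - 1 \<le> u \<and> u < real k" .
    have "0 \<le> u \<and> u \<le> 2 ^ n" if "real k - 1 \<le> u" "u < real k"
      using that kn by linarith
    then show ?thesis
      using idx_iff unfolding cell_side_def if_not_P[OF False] atLeastLessThan_iff lb ub idx le by blast
  qed
qed

lemma grid_cells_std_grid:
  "grid_cells a b (std_grid a b n) =
    (\<lambda>\<kappa>. {x \<in> cbox a b. cell_index a b n x = \<kappa>}) ` cell_indices n"
proof -
  have cell: "{x. \<forall>i. x $ i \<in> cell_side (2 ^ n) (dyadic_point a b n i) (k i)}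
      = {x \<in> cbox a b. cell_index a b n x = (\<lambda>i. int (k i) - 1)}" if "\<forall>i. k i \<in> {1..2 ^ n}" for k
    using that mem_cell_side_dyadic by (auto simp: mem_box_cart)
  show ?thesis
  proof (intro equalityI subsetI)
    fix C assume "C \<in> grid_cells a b (std_grid a b n)"
    then obtain m t k where C: "C = {x. \<forall>i. x $ i \<in> cell_side (m i) (t i) (k i)}"
      and p: "is_partition a b m t" and G: "std_grid a b n = grid_of m t" and k: "\<forall>i. k i \<in> {1..m i}"
      unfolding grid_cells_def by blast
    note eq = grid_determines_partition[OF is_partition_dyadic p G[unfolded std_grid_def]]
    have k: "\<forall>i. k i \<in> {1..2 ^ n}" and m: "m i = 2 ^ n" for i
      using k eq(1) by (auto simp: fun_eq_iff)
    have "k i \<le> 2 ^ n" "k i - 1 \<le> 2 ^ n" for i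
      using k by (auto intro: le_trans[OF diff_le_self])
    then have "t i (k i) = dyadic_point a b n i (k i)" "t i (k i - 1) = dyadic_point a b n i (k i - 1)" for i
      using eq(2)[of "k i" i] eq(2)[of "k i - 1" i] by simp_all
    then have "cell_side (m i) (t i) (k i) = cell_side (2 ^ n) (dyadic_point a b n i) (k i)" for i
      by (simp only: cell_side_def m)
    then have "C = {x \<in> cbox a b. cell_index a b n x = (\<lambda>i. int (k i) - 1)}"
      unfolding C cell[OF k, symmetric] by simp
    moreover have "int (k i) - 1 \<in> {0..2 ^ n - 1}" for i
    proof -
      have "int 1 \<le> int (k i)" "int (k i) \<le> int (2 ^ n)"
        using k unfolding of_nat_le_iff by auto
      then show ?thesis
        unfolding of_nat_power of_nat_numeral of_nat_1 atLeastAtMost_iff by linarith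
    qed
    then have "(\<lambda>i. int (k i) - 1) \<in> cell_indices n"
      by (simp only: cell_indices_def mem_Collect_eq) blast
    ultimately show "C \<in> (\<lambda>\<kappa>. {x \<in> cbox a b. cell_index a b n x = \<kappa>}) ` cell_indices n"
      by blast
  next
    fix C assume "C \<in> (\<lambda>\<kappa>. {x \<in> cbox a b. cell_index a b n x = \<kappa>}) ` cell_indices n"
    then obtain \<kappa> where C: "C = {x \<in> cbox a b. cell_index a b n x = \<kappa>}" and \<kappa>: "\<And>i. \<kappa> i \<in> {0..2 ^ n - 1}"
      by (auto simp: cell_indices_def)
    define k where "k i = nat (\<kappa> i) + 1" for i
    have "nat (\<kappa> i) < 2 ^ n" for i
      using \<kappa>[of i] by (simp add: nat_less_iff)
    then have k: "\<forall>i. k i \<in> {1..2 ^ n}"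
      by (simp add: k_def Suc_le_eq)
    have "\<kappa> = (\<lambda>i. int (k i) - 1)"
      using \<kappa> by (simp add: k_def fun_eq_iff)
    then have "C = {x. \<forall>i. x $ i \<in> cell_side (2 ^ n) (dyadic_point a b n i) (k i)}"
      using cell[OF k] C by simp
    then show "C \<in> grid_cells a b (std_grid a b n)"
      unfolding grid_cells_def std_grid_def mem_Collect_eq using k is_partition_dyadic[of n]
      by (intro exI[of _ "\<lambda>_. 2 ^ n"] exI[of _ "dyadic_point a b n"] exI[of _ k] conjI) simp_all
  qed
qed

lemma grid_constant_std_grid:
  "grid_constant a b (std_grid a b n) f \<longleftrightarrow>
    (\<forall>x\<in>cbox a b. \<forall>y\<in>cbox a b. cell_index a b n x = cell_index a b n y \<longrightarrow> f x = f y)"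
  (is "?L \<longleftrightarrow> ?R")
proof
  assume ?L
  show ?R
  proof (intro ballI impI)
    fix x y assume xy: "x \<in> cbox a b" "y \<in> cbox a b" "cell_index a b n x = cell_index a b n y"
    then obtain c where "\<forall>z\<in>{z \<in> cbox a b. cell_index a b n z = cell_index a b n x}. f z = c"
      using \<open>?L\<close> cell_index_in_cell_indices unfolding grid_constant_def grid_cells_std_grid by blast
    then show "f x = f y"
      using xy by simp
  qed
next
  assume ?R
  show ?L
    unfolding grid_constant_def grid_cells_std_grid
  proof (intro ballI)
    fix C assume "C \<in> (\<lambda>\<kappa>. {x \<in> cbox a b. cell_index a b n x = \<kappa>}) ` cell_indices n"
    then obtain \<kappa> where C: "C = {x \<in> cbox a b. cell_index a b n x = \<kappa>}" by blast
    then have "f x = f (SOME y. y \<in> C)" if "x \<in> C" for x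
      using \<open>?R\<close> that someI[of "\<lambda>y. y \<in> C" x] by auto
    then show "\<exists>c. \<forall>x\<in>C. f x = c" by blast
  qed
qed

lemma grid_constant_refine:
  assumes "grid_constant a b (std_grid a b n) f" "n \<le> n'"
  shows "grid_constant a b (std_grid a b n') f"
  using assms cell_index_eq_coarser unfolding grid_constant_std_grid by blast

lemma grid_constant_factors:
  assumes "grid_constant a b (std_grid a b n) f"
  obtains F where "\<And>x. x \<in> cbox a b \<Longrightarrow> f x = F (cell_index a b n x)"
proof
  fix x assume x: "x \<in> cbox a b"
  let ?y = "SOME y. y \<in> cbox a b \<and> cell_index a b n y = cell_index a b n x"
  have "?y \<in> cbox a b \<and> cell_index a b n ?y = cell_index a b n x"
    by (rule someI[of _ x]) (use x in simp)
  then show "f x = (\<lambda>\<kappa>. f (SOME y. y \<in> cbox a b \<and> cell_index a b n y = \<kappa>)) (cell_index a b n x)"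
    using assms x unfolding grid_constant_std_grid by metis
qed

lemma grid_constant_index: "grid_constant a b (std_grid a b n) (\<lambda>x. F (cell_index a b n x))"
  by (simp add: grid_constant_std_grid)

text \<open>The index type is countable, since \<open>'d\<close> is finite, so it suffices to look
  at preimages of single indices, which are finite intersections of coordinate conditions.\<close>

lemma measurable_cell_index:
  "cell_index a b n \<in> lebesgue_on (cbox a b) \<rightarrow>\<^sub>M count_space (UNIV :: ('d \<Rightarrow> int) set)"
proof -
  have nth: "(\<lambda>x::real^'d. x $ i) \<in> borel_measurable (lebesgue_on (cbox a b))" for i
    by (intro continuous_imp_measurable_on_sets_lebesgue continuous_intros) simp
  have "Measurable.pred (lebesgue_on (cbox a b)) (\<lambda>x. cell_index a b n x i = \<kappa> i)" for i \<kappa>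
    unfolding cell_index_def using nth[of i, measurable] by measurable
  then have "Measurable.pred (lebesgue_on (cbox a b)) (\<lambda>x. \<forall>i. cell_index a b n x i = \<kappa> i)" for \<kappa>
    by measurable
  then have "cell_index a b n -` {\<kappa>} \<inter> space (lebesgue_on (cbox a b)) \<in> sets (lebesgue_on (cbox a b))" for \<kappa>
    by (simp add: pred_def fun_eq_iff vimage_def Int_def conj_commute)
  then show ?thesis
    by (simp add: measurable_count_space_eq2_countable)
qed

lemma grid_constant_L2_space:
  assumes "grid_constant a b (std_grid a b n) f"
  shows "f \<in> L2_space (cbox a b)"
proof -
  obtain F where F: "\<And>x. x \<in> cbox a b \<Longrightarrow> f x = F (cell_index a b n x)"
    using grid_constant_factors[OF assms] by blast
  have "(\<lambda>x. F (cell_index a b n x)) \<in> borel_measurable (lebesgue_on (cbox a b))"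
    by (rule measurable_compose[OF measurable_cell_index]) simp
  then have "f \<in> borel_measurable (lebesgue_on (cbox a b))"
    by (rule measurable_cong[THEN iffD1, rotated]) (simp add: F)
  moreover have "AE x in lebesgue_on (cbox a b). \<bar>f x\<bar> \<le> Max ((\<lambda>\<kappa>. \<bar>F \<kappa>\<bar>) ` cell_indices n)"
  proof (rule AE_I2)
    fix x assume "x \<in> space (lebesgue_on (cbox a b))"
    then have "x \<in> cbox a b" by simp
    then show "\<bar>f x\<bar> \<le> Max ((\<lambda>\<kappa>. \<bar>F \<kappa>\<bar>) ` cell_indices n)"
      using cell_index_in_cell_indices finite_cell_indices F by (auto intro!: Max_ge)
  qed
  ultimately show ?thesis
    by (intro L2_space_AE_bounded) auto
qed

end

section \<open>Density of step functions\<close>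

definition cell_corner :: "real ^ 'd \<Rightarrow> real ^ 'd \<Rightarrow> nat \<Rightarrow> ('d \<Rightarrow> int) \<Rightarrow> real ^ 'd" where
  "cell_corner a b n \<kappa> = (\<chi> i. a $ i + of_int (\<kappa> i) * ((b $ i - a $ i) / 2 ^ n))"

text \<open>A closed box in place of the partly half-open cell: subinterval and translation rules
  for integrals apply to it directly, and it differs from the cell only on its faces, a negligible
  set.\<close>

definition cell_box :: "real ^ 'd \<Rightarrow> real ^ 'd \<Rightarrow> nat \<Rightarrow> ('d \<Rightarrow> int) \<Rightarrow> (real ^ 'd) set" where
  "cell_box a b n \<kappa> = cbox (cell_corner a b n \<kappa>) (cell_corner a b n (\<lambda>i. \<kappa> i + 1))"

lemma mem_cell_box:
  "x \<in> cell_box a b n \<kappa> \<longleftrightarrow>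
    (\<forall>i. cell_corner a b n \<kappa> $ i \<le> x $ i \<and> x $ i \<le> cell_corner a b n \<kappa> $ i + (b $ i - a $ i) / 2 ^ n)"
  unfolding cell_box_def mem_box_cart cell_corner_def vec_lambda_beta of_int_add distrib_right add.assoc
  by simp

definition grid_approximable :: "real ^ 'd \<Rightarrow> real ^ 'd \<Rightarrow> (real ^ 'd \<Rightarrow> real) \<Rightarrow> bool" where
  "grid_approximable a b f \<longleftrightarrow> f \<in> L2_space (cbox a b) \<and>
    (\<forall>e>0. \<exists>n h. grid_constant a b (std_grid a b n) h \<and>
      (\<integral>x. (h x - f x)\<^sup>2 \<partial>lebesgue_on (cbox a b)) < e)"

text \<open>The triangle inequality for squared distances, at the price of a factor 2.\<close>

lemma integral_dist_split:
  assumes f: "f \<in> L2_space Q" and g: "g \<in> L2_space Q" and h: "h \<in> L2_space Q"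
  shows "(\<integral>x. (h x - f x)\<^sup>2 \<partial>lebesgue_on Q)
    \<le> 2 * (\<integral>x. (h x - g x)\<^sup>2 \<partial>lebesgue_on Q) + 2 * (\<integral>x. (g x - f x)\<^sup>2 \<partial>lebesgue_on Q)"
proof -
  note int = L2_spaceD(2)[OF L2_space_diff]
  have "(\<integral>x. (h x - f x)\<^sup>2 \<partial>lebesgue_on Q)
      \<le> (\<integral>x. 2 * (h x - g x)\<^sup>2 + 2 * (g x - f x)\<^sup>2 \<partial>lebesgue_on Q)"
  proof (rule integral_mono)
    show "(h x - f x)\<^sup>2 \<le> 2 * (h x - g x)\<^sup>2 + 2 * (g x - f x)\<^sup>2" for x
      using power2_sum_le[of "h x - g x" "g x - f x"] by simp
  qed (use int[OF h f] int[OF h g] int[OF g f] in auto)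
  then show ?thesis
    using int[OF h g] int[OF g f] by simp
qed

context
  fixes a b :: "real ^ 'd"
  assumes ab: "\<And>i. a $ i < b $ i"
begin

lemma coordinate_eq_corner:
  "x $ i = a $ i + (2 ^ n * ((x $ i - a $ i) / (b $ i - a $ i))) * ((b $ i - a $ i) / 2 ^ n)"
  using ab[of i] by simp

lemma mem_cell_box_index:
  assumes "x \<in> cbox a b"
  shows "x \<in> cell_box a b n (cell_index a b n x)"
  unfolding cell_box_def mem_box_cart
proof
  fix i
  define u where "u = 2 ^ n * ((x $ i - a $ i) / (b $ i - a $ i))"
  define s where "s = (b $ i - a $ i) / 2 ^ n"
  have s: "0 < s" using ab[of i] by (simp add: s_def)
  have x: "x $ i = a $ i + u * s"
    unfolding u_def s_def by (rule coordinate_eq_corner)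
  have idx: "cell_index a b n x i = min \<lfloor>u\<rfloor> (2 ^ n - 1)"
    by (simp only: cell_index_def u_def)
  have "(x $ i - a $ i) / (b $ i - a $ i) \<le> 1"
    using assms ab[of i] by (auto simp: mem_box_cart)
  then have "u \<le> 2 ^ n"
    unfolding u_def by (intro mult_left_le) auto
  \<comment> \<open>Where the floor is below the cap this is the usual floor bound; where the cap is
    active the right-hand side is \<open>2 ^ n\<close>, which bounds \<open>u\<close> because
    \<open>x\<close> lies in the box.\<close>
  then have "u \<le> real_of_int (min \<lfloor>u\<rfloor> (2 ^ n - 1)) + 1"
    using real_of_int_floor_add_one_ge[of u] by (simp add: min_def)
  moreover have "real_of_int (min \<lfloor>u\<rfloor> (2 ^ n - 1)) \<le> u"
    by (rule order_trans[OF _ of_int_floor_le]) simp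
  ultimately show "cell_corner a b n (cell_index a b n x) $ i \<le> x $ i
      \<and> x $ i \<le> cell_corner a b n (\<lambda>i. cell_index a b n x i + 1) $ i"
    unfolding cell_corner_def vec_lambda_beta idx s_def[symmetric] of_int_add of_int_1 x
    using s by simp
qed

lemma cell_box_subset:
  assumes \<kappa>: "\<kappa> \<in> cell_indices n"
  shows "cell_box a b n \<kappa> \<subseteq> cbox a b"
proof
  fix x assume x: "x \<in> cell_box a b n \<kappa>"
  show "x \<in> cbox a b"
    unfolding mem_box_cart
  proof
    fix i
    define s where "s = (b $ i - a $ i) / 2 ^ n"
    have s: "0 < s" and b: "b $ i = a $ i + 2 ^ n * s" using ab[of i] by (simp_all add: s_def)
    have "0 \<le> \<kappa> i" "\<kappa> i + 1 \<le> 2 ^ n"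
      using \<kappa> by (auto simp: cell_indices_def add1_zle_eq)
    then have "0 \<le> real_of_int (\<kappa> i)" "real_of_int (\<kappa> i + 1) \<le> real_of_int (2 ^ n)"
      by (simp_all only: of_int_le_iff of_int_0_le_iff)
    then have "0 \<le> real_of_int (\<kappa> i) * s" "(real_of_int (\<kappa> i) + 1) * s \<le> 2 ^ n * s"
      using s by (auto intro!: mult_right_mono)
    moreover have "a $ i + real_of_int (\<kappa> i) * s \<le> x $ i" "x $ i \<le> a $ i + (real_of_int (\<kappa> i) + 1) * s"
      using x[unfolded cell_box_def mem_box_cart, rule_format, of i]
      unfolding cell_corner_def vec_lambda_beta s_def[symmetric] by simp_all
    ultimately show "a $ i \<le> x $ i \<and> x $ i \<le> b $ i"
      unfolding b by linarith
  qed
qed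

lemma cell_index_interior:
  assumes \<kappa>: "\<kappa> \<in> cell_indices n"
    and x: "x \<in> box (cell_corner a b n \<kappa>) (cell_corner a b n (\<lambda>i. \<kappa> i + 1))"
  shows "cell_index a b n x = \<kappa>"
proof
  fix i
  define u where "u = 2 ^ n * ((x $ i - a $ i) / (b $ i - a $ i))"
  define s where "s = (b $ i - a $ i) / 2 ^ n"
  have s: "0 < s" using ab[of i] by (simp add: s_def)
  have xi: "x $ i = a $ i + u * s"
    unfolding u_def s_def by (rule coordinate_eq_corner)
  have "a $ i + real_of_int (\<kappa> i) * s < x $ i" "x $ i < a $ i + (real_of_int (\<kappa> i) + 1) * s"
    using x[unfolded mem_box_cart, rule_format, of i]
    unfolding cell_corner_def vec_lambda_beta s_def[symmetric] by simp_all
  then have "real_of_int (\<kappa> i) < u" "u < real_of_int (\<kappa> i) + 1"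
    unfolding xi using s by simp_all
  then have "\<lfloor>u\<rfloor> = \<kappa> i" by linarith
  moreover have "\<kappa> i \<le> 2 ^ n - 1"
    using \<kappa> by (simp add: cell_indices_def)
  ultimately show "cell_index a b n x i = \<kappa> i"
    by (simp add: cell_index_def u_def)
qed

section \<open>From continuous to square-integrable functions\<close>

lemma uniform_grid_approx:
  assumes g: "continuous_on (cbox a b) g" and e: "0 < e"
  obtains n h where "grid_constant a b (std_grid a b n) h" "\<And>x. x \<in> cbox a b \<Longrightarrow> \<bar>h x - g x\<bar> < e"
proof -
  have "uniformly_continuous_on (cbox a b) g"
    using g compact_cbox by (rule compact_uniformly_continuous)
  then obtain d where d: "0 < d" "\<And>x y. x \<in> cbox a b \<Longrightarrow> y \<in> cbox a b \<Longrightarrow> dist y x < d \<Longrightarrow> dist (g y) (g x) < e"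
    using e unfolding uniformly_continuous_on_def by blast
  \<comment> \<open>The side sum bounds the diameter of the box, and \<open>S / 2 ^ n\<close> that
    of a cell. The quotient below uses \<open>S + 1\<close>, which is positive given only
    \<open>0 \<le> S\<close>.\<close>
  define S where "S = (\<Sum>i\<in>UNIV. b $ i - a $ i)"
  have S: "0 \<le> S"
    unfolding S_def using ab by (intro sum_nonneg) (simp add: less_imp_le)
  obtain n where "(1/2) ^ n < d / (S + 1)"
    using real_arch_pow_inv[of "d / (S + 1)" "1/2"] d(1) S by auto
  then have "(S + 1) * (1/2) ^ n < d"
    using S by (simp add: pos_less_divide_eq mult.commute)
  moreover have "S * (1/2) ^ n \<le> (S + 1) * (1/2) ^ n"
    by (intro mult_right_mono) auto
  ultimately have n: "S / 2 ^ n < d"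
    by (simp add: power_one_over)
  \<comment> \<open>The approximant samples \<open>g\<close> at the lower corner of the cell; the
    corner lies in the box, so uniform continuity applies to it.\<close>
  have "\<bar>g (cell_corner a b n (cell_index a b n x)) - g x\<bar> < e" if x: "x \<in> cbox a b" for x
  proof -
    let ?y = "cell_corner a b n (cell_index a b n x)"
    have box: "?y $ i \<le> x $ i" "x $ i \<le> ?y $ i + (b $ i - a $ i) / 2 ^ n" for i
      using mem_cell_box_index[OF x] unfolding mem_cell_box by auto
    have "?y \<in> cell_box a b n (cell_index a b n x)"
      using ab by (simp add: mem_cell_box less_imp_le)
    then have "?y \<in> cbox a b"
      using cell_box_subset cell_index_in_cell_indices[OF ab x] by blast
    moreover have "dist ?y x < d"
    proof -
      have "dist ?y x \<le> (\<Sum>i\<in>UNIV. \<bar>(?y - x) $ i\<bar>)"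
        unfolding dist_norm by (rule norm_le_l1_cart)
      also have "\<dots> \<le> (\<Sum>i\<in>UNIV. (b $ i - a $ i) / 2 ^ n)"
      proof (rule sum_mono)
        show "\<bar>(?y - x) $ i\<bar> \<le> (b $ i - a $ i) / 2 ^ n" for i
          using box[of i] by simp
      qed
      also have "\<dots> = S / 2 ^ n"
        by (simp add: S_def sum_divide_distrib)
      finally show ?thesis using n by simp
    qed
    ultimately show ?thesis
      using d(2)[OF x] by (simp add: dist_real_def)
  qed
  then show thesis
    using that[OF grid_constant_index[OF ab, of n "\<lambda>\<kappa>. g (cell_corner a b n \<kappa>)"]] by blast
qed

text \<open>Approximability survives limits in \<open>L\<^sup>2\<close>; errors of
  \<open>e / 4\<close> absorb the factor 2 on each part of the split.\<close>

lemma grid_approximable_if_approximated: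
  assumes f: "f \<in> L2_space (cbox a b)"
    and approx: "\<And>e. 0 < e \<Longrightarrow> \<exists>g. grid_approximable a b g \<and> (\<integral>x. (g x - f x)\<^sup>2 \<partial>lebesgue_on (cbox a b)) < e"
  shows "grid_approximable a b f"
  unfolding grid_approximable_def
proof (intro conjI allI impI f)
  fix e :: real assume "0 < e"
  then obtain g where g: "grid_approximable a b g" "(\<integral>x. (g x - f x)\<^sup>2 \<partial>lebesgue_on (cbox a b)) < e / 4"
    using approx[of "e / 4"] by auto
  then obtain n h where h: "grid_constant a b (std_grid a b n) h" "(\<integral>x. (h x - g x)\<^sup>2 \<partial>lebesgue_on (cbox a b)) < e / 4"
    using \<open>0 < e\<close> unfolding grid_approximable_def by (meson divide_pos_pos zero_less_numeral)
  have "(\<integral>x. (h x - f x)\<^sup>2 \<partial>lebesgue_on (cbox a b)) < e"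
    using integral_dist_split[OF f _ grid_constant_L2_space[OF ab h(1)], of g] g h(2)
    by (simp add: grid_approximable_def)
  then show "\<exists>n h. grid_constant a b (std_grid a b n) h \<and> (\<integral>x. (h x - f x)\<^sup>2 \<partial>lebesgue_on (cbox a b)) < e"
    using h(1) by blast
qed

lemma grid_approximable_continuous:
  assumes g: "continuous_on (cbox a b) g"
  shows "grid_approximable a b g"
  unfolding grid_approximable_def
proof (intro conjI allI impI)
  let ?M = "lebesgue_on (cbox a b)"
  interpret finite_measure ?M
    by (rule finite_measure_lebesgue_on) simp
  have gm: "g \<in> borel_measurable ?M"
    using g by (rule continuous_imp_measurable_on_sets_lebesgue) simp
  obtain B where "\<And>x. x \<in> cbox a b \<Longrightarrow> \<bar>g x\<bar> \<le> B"
    using compact_imp_bounded[OF compact_continuous_image[OF g compact_cbox]] by (auto simp: bounded_iff)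
  then show g2: "g \<in> L2_space (cbox a b)"
    by (intro L2_space_AE_bounded gm AE_I2) auto
  fix e :: real assume e: "0 < e"
  \<comment> \<open>A uniform error \<open>\<delta>\<close> costs \<open>\<delta>\<^sup>2\<close>
    times the measure; adding 1 in the denominator keeps it positive and makes the final bound
    strictly smaller than \<open>e\<close>.\<close>
  define \<delta> where "\<delta> = sqrt (e / (measure ?M (cbox a b) + 1))"
  have pos: "0 < measure ?M (cbox a b) + 1"
    using measure_nonneg[of ?M "cbox a b"] by linarith
  then have \<delta>: "0 < \<delta>" "\<delta>\<^sup>2 = e / (measure ?M (cbox a b) + 1)"
    using e by (auto simp: \<delta>_def)
  obtain n h where h: "grid_constant a b (std_grid a b n) h" "\<And>x. x \<in> cbox a b \<Longrightarrow> \<bar>h x - g x\<bar> < \<delta>"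
    using uniform_grid_approx[OF g \<delta>(1)] by blast
  have "(\<integral>x. (h x - g x)\<^sup>2 \<partial>?M) \<le> (\<integral>x. \<delta>\<^sup>2 \<partial>?M)"
  proof (rule integral_mono_AE)
    show "integrable ?M (\<lambda>x. (h x - g x)\<^sup>2)"
      by (intro L2_spaceD L2_space_diff g2 grid_constant_L2_space[OF ab h(1)])
    show "AE x in ?M. (h x - g x)\<^sup>2 \<le> \<delta>\<^sup>2"
    proof (rule AE_I2)
      fix x assume "x \<in> space ?M"
      then have "\<bar>h x - g x\<bar> \<le> \<delta>" using h(2) by (simp add: less_imp_le)
      from power_mono[OF this, of 2] show "(h x - g x)\<^sup>2 \<le> \<delta>\<^sup>2" by simp
    qed
  qed simp
  also have "\<dots> = measure ?M (cbox a b) * (e / (measure ?M (cbox a b) + 1))"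
    by (simp add: \<delta>)
  also have "\<dots> < e"
    using pos e by (simp add: field_simps)
  finally show "\<exists>n h. grid_constant a b (std_grid a b n) h \<and> (\<integral>x. (h x - g x)\<^sup>2 \<partial>?M) < e"
    using h(1) by blast
qed

lemma grid_approximable_bounded:
  assumes f: "f \<in> borel_measurable (lebesgue_on (cbox a b))" and M: "\<And>x. \<bar>f x\<bar> \<le> M"
  shows "grid_approximable a b f"
proof (rule grid_approximable_if_approximated)
  let ?M = "lebesgue_on (cbox a b)"
  interpret finite_measure ?M
    by (rule finite_measure_lebesgue_on) simp
  show f2: "f \<in> L2_space (cbox a b)"
    using M by (intro L2_space_AE_bounded[OF f]) auto
  fix e :: real assume e: "0 < e"
  have "f measurable_on cbox a b"
    by (subst measurable_on_iff_borel_measurable) (use f in simp_all)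
  then obtain N g where N: "negligible N" and g: "\<And>n. continuous_on UNIV (g n)"
    and lim: "\<And>x. x \<notin> N \<Longrightarrow> (\<lambda>n. g n x) \<longlonglongrightarrow> (if x \<in> cbox a b then f x else 0)"
    unfolding measurable_on_def by blast
  \<comment> \<open>The continuous approximants converge only a.e. and come without a common bound.
    Clipping at the bound of \<open>f\<close> keeps continuity and the limit, and supplies the
    constant majorant \<open>(2 * M)\<^sup>2\<close>.\<close>
  define c where "c n x = max (- M) (min M (g n x))" for n x
  have c: "continuous_on (cbox a b) (c n)" for n
    unfolding c_def using continuous_on_subset[OF g] by (intro continuous_intros) auto
  have cm: "c n \<in> borel_measurable (lebesgue_on (cbox a b))" for n
    using c by (rule continuous_imp_measurable_on_sets_lebesgue) simp
  have M0: "0 \<le> M"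
    using M[of 0] by linarith
  have "AE x in lebesgue. x \<notin> N"
    using N by (simp add: negligible_iff_null_sets AE_not_in)
  then have aeN: "AE x in ?M. x \<notin> N"
    by (subst AE_restrict_space_iff) auto
  have "(\<lambda>n. \<integral>x. (c n x - f x)\<^sup>2 \<partial>?M) \<longlonglongrightarrow> (\<integral>x. 0 \<partial>?M)"
  proof (rule integral_dominated_convergence[where w="\<lambda>_. (2 * M)\<^sup>2"])
    show "(\<lambda>x. (c n x - f x)\<^sup>2) \<in> borel_measurable ?M" for n
      using f cm[of n] by measurable
    show "AE x in ?M. (\<lambda>n. (c n x - f x)\<^sup>2) \<longlonglongrightarrow> 0"
      using aeN AE_space
    proof eventually_elim
      case (elim x)
      then have "(\<lambda>n. g n x) \<longlonglongrightarrow> f x"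
        using lim[of x] by simp
      then have "(\<lambda>n. (c n x - f x)\<^sup>2) \<longlonglongrightarrow> (max (- M) (min M (f x)) - f x)\<^sup>2"
        unfolding c_def by (intro tendsto_intros)
      moreover have "max (- M) (min M (f x)) = f x"
        using M[of x] by auto
      ultimately show ?case by simp
    qed
    show "AE x in ?M. norm ((c n x - f x)\<^sup>2) \<le> (2 * M)\<^sup>2" for n
    proof (rule AE_I2)
      fix x
      have "\<bar>c n x - f x\<bar> \<le> 2 * M"
        using M[of x] M0 by (auto simp: c_def)
      from power_mono[OF this, of 2] show "norm ((c n x - f x)\<^sup>2) \<le> (2 * M)\<^sup>2" by simp
    qed
  qed auto
  then have "\<forall>\<^sub>F n in sequentially. (\<integral>x. (c n x - f x)\<^sup>2 \<partial>?M) < e"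
    using e by (intro order_tendstoD(2)) auto
  then obtain n where "(\<integral>x. (c n x - f x)\<^sup>2 \<partial>?M) < e"
    by (auto simp: eventually_sequentially)
  then show "\<exists>g. grid_approximable a b g \<and> (\<integral>x. (g x - f x)\<^sup>2 \<partial>?M) < e"
    using grid_approximable_continuous[OF c] by blast
qed

text \<open>Truncation at height \<open>n\<close> reduces to bounded functions: the error vanishes
  at each point for large \<open>n\<close> and its square is dominated by
  \<open>(f x)\<^sup>2\<close>.\<close>

lemma grid_approximable_L2:
  assumes f: "f \<in> L2_space (cbox a b)"
  shows "grid_approximable a b f"
proof (rule grid_approximable_if_approximated[OF f])
  let ?M = "lebesgue_on (cbox a b)"
  fix e :: real assume e: "0 < e"
  define c where "c n x = max (- real n) (min (real n) (f x))" for n x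
  have cm: "c n \<in> borel_measurable ?M" for n
    unfolding c_def using L2_spaceD(1)[OF f] by measurable
  have "(\<lambda>n. \<integral>x. (c n x - f x)\<^sup>2 \<partial>?M) \<longlonglongrightarrow> (\<integral>x. 0 \<partial>?M)"
  proof (rule integral_dominated_convergence[where w="\<lambda>x. (f x)\<^sup>2"])
    show "(\<lambda>x. (c n x - f x)\<^sup>2) \<in> borel_measurable ?M" for n
      using cm[of n] L2_spaceD(1)[OF f] by measurable
    show "AE x in ?M. (\<lambda>n. (c n x - f x)\<^sup>2) \<longlonglongrightarrow> 0"
    proof (rule AE_I2)
      fix x
      obtain m where "\<bar>f x\<bar> \<le> real m" using real_arch_simple by blast
      then have "\<forall>n\<ge>m. (c n x - f x)\<^sup>2 = 0"
        by (auto simp: c_def)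
      then have "\<forall>\<^sub>F n in sequentially. (c n x - f x)\<^sup>2 = 0"
        unfolding eventually_sequentially by blast
      then show "(\<lambda>n. (c n x - f x)\<^sup>2) \<longlonglongrightarrow> 0"
        by (rule tendsto_eventually)
    qed
    show "AE x in ?M. norm ((c n x - f x)\<^sup>2) \<le> (f x)\<^sup>2" for n
    proof (rule AE_I2)
      fix x
      have "\<bar>c n x - f x\<bar> \<le> \<bar>f x\<bar>"
        by (auto simp: c_def)
      from power_mono[OF this, of 2] show "norm ((c n x - f x)\<^sup>2) \<le> (f x)\<^sup>2" by simp
    qed
  qed (use L2_spaceD[OF f] in auto)
  then have "\<forall>\<^sub>F n in sequentially. (\<integral>x. (c n x - f x)\<^sup>2 \<partial>?M) < e"
    using e by (intro order_tendstoD(2)) auto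
  then obtain n where "(\<integral>x. (c n x - f x)\<^sup>2 \<partial>?M) < e"
    by (auto simp: eventually_sequentially)
  moreover have "grid_approximable a b (c n)"
    by (rule grid_approximable_bounded[OF cm, of _ "real n"]) (auto simp: c_def)
  ultimately show "\<exists>g. grid_approximable a b g \<and> (\<integral>x. (g x - f x)\<^sup>2 \<partial>?M) < e"
    by blast
qed

end

section \<open>Essential bounds\<close>

lemma AE_le_Linf_norm:
  assumes "Linf_norm Q f < ereal e"
  shows "AE x in lebesgue_on Q. \<bar>f x\<bar> \<le> e"
proof -
  have "AE x in lebesgue_on Q. ereal \<bar>f x\<bar> \<le> Linf_norm Q f"
    unfolding Linf_norm_def by (rule esssup_AE)
  then show ?thesis
  proof eventually_elim
    case (elim x)
    then have "ereal \<bar>f x\<bar> < ereal e"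
      using assms by (rule le_less_trans)
    then show ?case by simp
  qed
qed

context
  fixes a b :: "real ^ 'd"
  assumes ab: "\<And>i. a $ i < b $ i"
begin

lemma emeasure_box_nonzero: "emeasure (lebesgue_on (cbox a b)) (space (lebesgue_on (cbox a b))) \<noteq> 0"
proof
  assume "emeasure (lebesgue_on (cbox a b)) (space (lebesgue_on (cbox a b))) = 0"
  then have "cbox a b \<in> null_sets lebesgue"
    by (simp add: emeasure_restrict_space null_sets_def)
  then have "box a b = {}"
    by (simp add: negligible_iff_null_sets[symmetric] negligible_interval)
  then obtain i where "b $ i \<le> a $ i"
    by (auto simp: interval_eq_empty_cart)
  then show False
    using ab[of i] by simp
qed

text \<open>Nondegeneracy of the box. Each lower bound on an essential supremum below is obtained by
  contradiction with this fact.\<close>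

lemma not_AE_False: "\<not> (AE x in lebesgue_on (cbox a b). False)"
  using emeasure_box_nonzero ae_filter_eq_bot_iff[of "lebesgue_on (cbox a b)"]
  by (simp add: trivial_limit_def)

lemma Linf_norm_nonneg: "0 \<le> Linf_norm (cbox a b) f"
proof (rule ccontr)
  assume neg: "\<not> 0 \<le> Linf_norm (cbox a b) f"
  have "AE x in lebesgue_on (cbox a b). ereal \<bar>f x\<bar> \<le> Linf_norm (cbox a b) f"
    unfolding Linf_norm_def by (rule esssup_AE)
  then have "AE x in lebesgue_on (cbox a b). False"
  proof eventually_elim
    case (elim x)
    have "0 \<le> ereal \<bar>f x\<bar>" by simp
    with elim neg show ?case by (metis order_trans)
  qed
  then show False
    using not_AE_False by simp
qed

text \<open>\<open>real_of_ereal\<close> sends infinite values to 0, so the extended essential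
  supremum has to be enclosed between finite bounds before \<open>ess_sup\<close> can stand for
  it.\<close>

lemma AE_le_ess_sup:
  assumes w: "w \<in> borel_measurable (lebesgue_on (cbox a b))"
    and K: "AE x in lebesgue_on (cbox a b). \<bar>w x\<bar> \<le> K"
  shows "AE x in lebesgue_on (cbox a b). w x \<le> ess_sup (cbox a b) w"
proof -
  let ?M = "lebesgue_on (cbox a b)"
  let ?s = "esssup ?M (\<lambda>x. ereal (w x))"
  have AE: "AE x in ?M. ereal (w x) \<le> ?s"
    by (rule esssup_AE)
  have "?s \<le> ereal K"
    using w K by (intro esssup_I) (auto elim!: eventually_mono)
  moreover have "ereal (- K) \<le> ?s"
  proof (rule ccontr)
    assume less: "\<not> ereal (- K) \<le> ?s"
    have "AE x in ?M. False"
      using AE K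
    proof eventually_elim
      case (elim x)
      then have "ereal (- K) \<le> ereal (w x)" by simp
      with elim(1) less show ?case by (metis order_trans)
    qed
    then show False
      using not_AE_False by simp
  qed
  ultimately have "?s = ereal (ess_sup (cbox a b) w)"
    unfolding ess_sup_def by (intro ereal_real'[symmetric]) auto
  with AE show ?thesis by simp
qed

lemma ess_sup_le:
  assumes w: "w \<in> borel_measurable (lebesgue_on (cbox a b))"
    and K: "AE x in lebesgue_on (cbox a b). \<bar>w x\<bar> \<le> K"
    and C: "AE x in lebesgue_on (cbox a b). w x \<le> C"
  shows "ess_sup (cbox a b) w \<le> C"
proof -
  let ?M = "lebesgue_on (cbox a b)"
  let ?s = "esssup ?M (\<lambda>x. ereal (w x))"
  have s: "?s \<le> ereal C"
    using w C by (intro esssup_I) auto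
  have "?s \<noteq> - \<infinity>"
  proof
    assume "?s = - \<infinity>"
    then have "AE x in ?M. False"
      using esssup_AE[of "\<lambda>x. ereal (w x)" ?M] by simp
    then show False
      using not_AE_False by simp
  qed
  with s show ?thesis
    unfolding ess_sup_def by (cases ?s) auto
qed

text \<open>Makes the essential bounds admissible as \<open>c\<close> and \<open>K\<close>, which
  turns the general factor \<open>sqrt (K / c)\<close> into the constant C. Positivity of the lower
  one comes from \<open>- w x \<le> - c\<close>.\<close>

lemma weight_ess_bounds:
  assumes w: "weight (cbox a b) w c K"
  shows "weight (cbox a b) w (ess_inf (cbox a b) w) (ess_sup (cbox a b) w)"
proof -
  have m: "w \<in> borel_measurable (lebesgue_on (cbox a b))" "(\<lambda>x. - w x) \<in> borel_measurable (lebesgue_on (cbox a b))"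
    using weightD(1)[OF w] by auto
  have K: "AE x in lebesgue_on (cbox a b). \<bar>w x\<bar> \<le> K" "AE x in lebesgue_on (cbox a b). \<bar>- w x\<bar> \<le> K"
    using weightD(4)[OF w] by simp_all
  have "AE x in lebesgue_on (cbox a b). - w x \<le> - c"
    using weightD(3)[OF w] by eventually_elim simp
  from ess_sup_le[OF m(2) K(2) this] have "0 < ess_inf (cbox a b) w"
    using weightD(2)[OF w] by (simp add: ess_inf_def)
  moreover have "AE x in lebesgue_on (cbox a b). ess_inf (cbox a b) w \<le> w x \<and> w x \<le> ess_sup (cbox a b) w"
    using AE_le_ess_sup[OF m(1) K(1)] AE_le_ess_sup[OF m(2) K(2)]
    by eventually_elim (simp add: ess_inf_def)
  ultimately show ?thesis
    using m(1) by (simp add: weight_def)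
qed

lemma S_inf_pos_weight_approx:
  assumes w: "w \<in> S_inf_pos a b"
  obtains c K wn l where "weight (cbox a b) w c K" "\<And>n. weight (cbox a b) (wn n) c K"
    "\<And>n. grid_constant a b (std_grid a b (l n)) (wn n)" "\<And>n x. x \<in> cbox a b \<Longrightarrow> 0 < wn n x"
    "\<And>n. Linf_norm (cbox a b) (\<lambda>x. wn n x - w x) < ereal (1 / real (Suc n))"
proof -
  let ?M = "lebesgue_on (cbox a b)"
  obtain c where c: "0 < c" and wL: "w \<in> Linf_space (cbox a b)"
    and approx: "\<And>\<epsilon>. 0 < \<epsilon> \<Longrightarrow> \<exists>s\<in>S_space a b {c..}. Linf_norm (cbox a b) (\<lambda>x. s x - w x) < ereal \<epsilon>"
    using w unfolding S_inf_pos_def Linf_closure_def by auto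
  have wm: "w \<in> borel_measurable ?M"
    using wL by (simp add: Linf_space_def)
  obtain K :: nat where "Linf_norm (cbox a b) w < ereal (real K)"
    using wL less_PInf_Ex_of_nat[of "Linf_norm (cbox a b) w"] by (auto simp: Linf_space_def)
  then have K: "AE x in ?M. \<bar>w x\<bar> \<le> real K"
    by (rule AE_le_Linf_norm)
  have "\<forall>n. \<exists>s. s \<in> S_space a b {c..} \<and> Linf_norm (cbox a b) (\<lambda>x. s x - w x) < ereal (1 / real (Suc n))"
    using approx by (meson divide_pos_pos of_nat_0_less_iff zero_less_Suc zero_less_one)
  then obtain wn where wn: "\<And>n. wn n \<in> S_space a b {c..}"
      "\<And>n. Linf_norm (cbox a b) (\<lambda>x. wn n x - w x) < ereal (1 / real (Suc n))"
    by metis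
  have "\<exists>l. grid_constant a b (std_grid a b l) (wn n)" for n
    using wn(1)[of n] dyadic_grid_iff[OF ab] by (auto simp: S_space_def dyadically_grid_constant_def)
  then obtain l where l: "\<And>n. grid_constant a b (std_grid a b (l n)) (wn n)"
    by metis
  have lower: "c \<le> wn n x" if "x \<in> cbox a b" for n x
    using wn(1)[of n] that by (auto simp: S_space_def)
  have near: "AE x in ?M. \<bar>wn n x - w x\<bar> \<le> 1 / real (Suc n)" for n
    using wn(2) by (rule AE_le_Linf_norm)
  \<comment> \<open>Bounds common to \<open>w\<close> and all \<open>wn n\<close>: an approximant
    with values at least \<open>c\<close> and error below \<open>c / 2\<close> forces
    \<open>w\<close> above \<open>c / 2\<close>, and errors of at most 1 raise the upper bound by at
    most 1.\<close>
  have "weight (cbox a b) w (c / 2) (real K + 1)"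
    unfolding weight_def
  proof (intro conjI wm)
    obtain s where s: "s \<in> S_space a b {c..}" "Linf_norm (cbox a b) (\<lambda>x. s x - w x) < ereal (c / 2)"
      using approx[of "c / 2"] c by auto
    show "AE x in ?M. c / 2 \<le> w x \<and> w x \<le> real K + 1"
      using K AE_le_Linf_norm[OF s(2)] AE_space
    proof eventually_elim
      case (elim x)
      then have "c \<le> s x"
        using s(1) by (simp add: S_space_def)
      with elim show ?case by linarith
    qed
  qed (use c in simp)
  moreover have "weight (cbox a b) (wn n) (c / 2) (real K + 1)" for n
    unfolding weight_def
  proof (intro conjI)
    show "wn n \<in> borel_measurable ?M"
      by (intro L2_spaceD grid_constant_L2_space[OF ab l])
    show "AE x in ?M. c / 2 \<le> wn n x \<and> wn n x \<le> real K + 1"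
      using K near[of n] AE_space
    proof eventually_elim
      case (elim x)
      then have "c \<le> wn n x"
        using lower by simp
      moreover have "1 / real (Suc n) \<le> 1" by simp
      ultimately show ?case
        using elim c by linarith
    qed
  qed (use c in simp)
  moreover have "0 < wn n x" if "x \<in> cbox a b" for n x
    using lower[OF that, of n] c by simp
  ultimately show thesis
    using that l wn(2) by blast
qed

end

section \<open>Cell averages\<close>

text \<open>The denominator is the volume shared by all cells of a dyadic grid, so comparing
  averages amounts to comparing integrals.\<close>

definition grid_average :: "real ^ 'd \<Rightarrow> real ^ 'd \<Rightarrow> nat \<Rightarrow> (real ^ 'd \<Rightarrow> real) \<Rightarrow> real ^ 'd \<Rightarrow> real" where
  "grid_average a b n g x = integral (cell_box a b n (cell_index a b n x)) g / (\<Prod>i\<in>UNIV. (b $ i - a $ i) / 2 ^ n)"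

context
  fixes a b :: "real ^ 'd"
  assumes ab: "\<And>i. a $ i < b $ i"
begin

lemma S_sigma_subset_L2_sigma: "S_sigma \<sigma> a b UNIV \<subseteq> L2_sigma \<sigma> (cbox a b)"
proof
  fix h assume h: "h \<in> S_sigma \<sigma> a b UNIV"
  then obtain n where "grid_constant a b (std_grid a b n) h"
    using dyadic_grid_iff[OF ab] by (auto simp: S_sigma_def S_space_def dyadically_grid_constant_def)
  then have "h \<in> L2_space (cbox a b)"
    by (rule grid_constant_L2_space[OF ab])
  moreover have "sigma_monotonic \<sigma> (cbox a b - {}) h"
    using h by (simp add: S_sigma_def)
  ultimately show "h \<in> L2_sigma \<sigma> (cbox a b)"
    unfolding L2_sigma_def by blast
qed

lemma content_cell_box:
  "measure lborel (cell_box a b n \<kappa>) = (\<Prod>i\<in>UNIV. (b $ i - a $ i) / 2 ^ n)"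
proof -
  have "cell_corner a b n \<kappa> \<in> cell_box a b n \<kappa>"
    using ab by (simp add: mem_cell_box less_imp_le)
  then have "measure lborel (cell_box a b n \<kappa>) = (\<Prod>i\<in>UNIV. cell_corner a b n (\<lambda>i. \<kappa> i + 1) $ i - cell_corner a b n \<kappa> $ i)"
    unfolding cell_box_def by (intro content_cbox_cart) auto
  also have "\<dots> = (\<Prod>i\<in>UNIV. (b $ i - a $ i) / 2 ^ n)"
    unfolding cell_corner_def vec_lambda_beta of_int_add distrib_right by (intro prod.cong) auto
  finally show ?thesis .
qed

lemma cell_volume_pos: "0 < (\<Prod>i\<in>UNIV. (b $ i - a $ i) / 2 ^ n)"
  using ab by (intro prod_pos) simp

text \<open>The cell lies between the open and the closed box, whose difference is
  negligible.\<close>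

lemma integral_over_cell:
  fixes \<phi> :: "real ^ 'd \<Rightarrow> real"
  assumes \<kappa>: "\<kappa> \<in> cell_indices n"
  shows "integral (cbox a b) (\<lambda>x. if cell_index a b n x = \<kappa> then \<phi> x else 0) = integral (cell_box a b n \<kappa>) \<phi>"
proof -
  let ?B = "cell_box a b n \<kappa>"
  let ?F = "?B - box (cell_corner a b n \<kappa>) (cell_corner a b n (\<lambda>i. \<kappa> i + 1))"
  have "integral (cbox a b) (\<lambda>x. if cell_index a b n x = \<kappa> then \<phi> x else 0)
      = integral (cbox a b) (\<lambda>x. if x \<in> ?B then \<phi> x else 0)"
  proof (rule integral_spike)
    show "negligible ?F"
      unfolding cell_box_def by (rule negligible_frontier_interval)
    show "(if x \<in> ?B then \<phi> x else 0) = (if cell_index a b n x = \<kappa> then \<phi> x else 0)"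
      if "x \<in> cbox a b - ?F" for x
      using that mem_cell_box_index[OF ab, of x n] cell_index_interior[OF ab \<kappa>, of x] by auto
  qed
  also have "\<dots> = integral (cbox a b \<inter> ?B) \<phi>"
    by (subst Int_commute) (rule Henstock_Kurzweil_Integration.integral_restrict_Int)
  also have "cbox a b \<inter> ?B = ?B"
    using cell_box_subset[OF ab \<kappa>] by blast
  finally show ?thesis .
qed

lemma L2_integrable_on:
  assumes g: "g \<in> L2_space (cbox a b)"
  shows "g integrable_on cbox a b"
proof -
  have "(\<lambda>_. 1) \<in> L2_space (cbox a b)"
    by (rule L2_space_AE_bounded[of _ _ 1]) auto
  then have "integrable (lebesgue_on (cbox a b)) g"
    using integrable_L2_mult[OF g] by fastforce
  then show ?thesis
    by (rule integrable_on_lebesgue_on) simp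
qed

lemma grid_average_grid_constant: "grid_constant a b (std_grid a b n) (grid_average a b n g)"
  by (simp add: grid_constant_std_grid[OF ab] grid_average_def)

text \<open>Averaging is the orthogonal projection onto the functions constant on cells: the
  residual integrates to 0 over each cell, and \<open>h\<close> is a finite combination of cell
  indicators.\<close>

lemma integral_grid_constant_mult_grid_average_diff:
  assumes g: "g \<in> L2_space (cbox a b)" and h: "grid_constant a b (std_grid a b n) h"
  shows "(\<integral>x. h x * (grid_average a b n g x - g x) \<partial>lebesgue_on (cbox a b)) = 0"
proof -
  let ?M = "lebesgue_on (cbox a b)"
  let ?A = "grid_average a b n g"
  obtain H where H: "\<And>x. x \<in> cbox a b \<Longrightarrow> h x = H (cell_index a b n x)"
    using grid_constant_factors[OF ab h] by blast
  define \<psi> where "\<psi> \<kappa> x = (if cell_index a b n x = \<kappa> then ?A x - g x else 0)" for \<kappa> x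
  have A: "?A \<in> L2_space (cbox a b)"
    by (rule grid_constant_L2_space[OF ab grid_average_grid_constant])
  have int: "integrable ?M (\<psi> \<kappa>)" for \<kappa>
  proof -
    have "(\<lambda>x. if cell_index a b n x = \<kappa> then 1 else 0) \<in> L2_space (cbox a b)"
      by (rule grid_constant_L2_space[OF ab, of n]) (simp add: grid_constant_std_grid[OF ab])
    from integrable_L2_mult[OF this L2_space_diff[OF A g]] show ?thesis
      by (rule Bochner_Integration.integrable_cong[THEN iffD1, rotated 2]) (auto simp: \<psi>_def)
  qed
  have zero: "(\<integral>x. \<psi> \<kappa> x \<partial>?M) = 0" if \<kappa>: "\<kappa> \<in> cell_indices n" for \<kappa>
  proof -
    let ?B = "cell_box a b n \<kappa>" and ?V = "\<Prod>i\<in>UNIV. (b $ i - a $ i) / 2 ^ n"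
    have \<psi>_eq: "\<psi> \<kappa> = (\<lambda>x. if cell_index a b n x = \<kappa> then integral ?B g / ?V - g x else 0)"
      by (auto simp: \<psi>_def grid_average_def)
    have gB: "g integrable_on ?B"
      using integrable_on_subcbox[OF L2_integrable_on[OF g]] cell_box_subset[OF ab \<kappa>] by (simp add: cell_box_def)
    have "(\<integral>x. \<psi> \<kappa> x \<partial>?M) = integral (cbox a b) (\<psi> \<kappa>)"
      by (rule lebesgue_integral_eq_integral[OF int]) simp
    also have "\<dots> = integral ?B (\<lambda>x. integral ?B g / ?V - g x)"
      unfolding \<psi>_eq by (rule integral_over_cell[OF \<kappa>])
    also have "\<dots> = integral ?B (\<lambda>x. integral ?B g / ?V) - integral ?B g"
      using gB unfolding cell_box_def
      by (intro Henstock_Kurzweil_Integration.integral_diff Henstock_Kurzweil_Integration.integrable_const)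
    also have "integral ?B (\<lambda>x. integral ?B g / ?V) = measure lborel ?B * (integral ?B g / ?V)"
      unfolding cell_box_def by (simp only: integral_const real_scaleR_def)
    also have "\<dots> = integral ?B g"
    proof -
      have "v * (u / v) = u" if "0 < v" for u v :: real
        using that by simp
      then show ?thesis
        unfolding content_cell_box using cell_volume_pos by blast
    qed
    finally show ?thesis unfolding diff_self .
  qed
  have "(\<integral>x. h x * (?A x - g x) \<partial>?M) = (\<integral>x. (\<Sum>\<kappa>\<in>cell_indices n. H \<kappa> * \<psi> \<kappa> x) \<partial>?M)"
  proof (rule Bochner_Integration.integral_cong[OF refl])
    fix x assume "x \<in> space ?M"
    then have x: "x \<in> cbox a b" by simp
    have "(\<Sum>\<kappa>\<in>cell_indices n. H \<kappa> * \<psi> \<kappa> x)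
        = (\<Sum>\<kappa>\<in>cell_indices n. if cell_index a b n x = \<kappa> then H \<kappa> * (?A x - g x) else 0)"
      by (intro sum.cong) (auto simp: \<psi>_def)
    also have "\<dots> = H (cell_index a b n x) * (?A x - g x)"
      using cell_index_in_cell_indices[OF ab x] by (simp add: sum.delta'[OF finite_cell_indices])
    finally show "h x * (?A x - g x) = (\<Sum>\<kappa>\<in>cell_indices n. H \<kappa> * \<psi> \<kappa> x)"
      using H[OF x] by simp
  qed
  also have "\<dots> = (\<Sum>\<kappa>\<in>cell_indices n. H \<kappa> * (\<integral>x. \<psi> \<kappa> x \<partial>?M))"
    using int by simp
  also have "\<dots> = 0"
    using zero by simp
  finally show ?thesis .
qed

text \<open>Pythagoras: \<open>h\<close> minus the average is again constant on cells, so the cross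
  term vanishes by orthogonality.\<close>

lemma grid_average_best_approximation:
  assumes g: "g \<in> L2_space (cbox a b)" and h: "grid_constant a b (std_grid a b n) h"
  shows "(\<integral>x. (grid_average a b n g x - g x)\<^sup>2 \<partial>lebesgue_on (cbox a b))
    \<le> (\<integral>x. (h x - g x)\<^sup>2 \<partial>lebesgue_on (cbox a b))"
proof -
  let ?M = "lebesgue_on (cbox a b)"
  let ?A = "grid_average a b n g"
  have hA: "grid_constant a b (std_grid a b n) (\<lambda>x. h x - ?A x)"
    using h grid_average_grid_constant[of n g] unfolding grid_constant_std_grid[OF ab] by metis
  have Ag: "(\<lambda>x. ?A x - g x) \<in> L2_space (cbox a b)"
    by (intro L2_space_diff g grid_constant_L2_space[OF ab grid_average_grid_constant])
  have hA2: "(\<lambda>x. h x - ?A x) \<in> L2_space (cbox a b)"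
    by (rule grid_constant_L2_space[OF ab hA])
  note int = integrable_L2_mult[OF hA2 Ag] L2_spaceD(2)[OF Ag] L2_spaceD(2)[OF hA2]
  have "(\<integral>x. (h x - g x)\<^sup>2 \<partial>?M)
      = (\<integral>x. (h x - ?A x)\<^sup>2 + 2 * ((h x - ?A x) * (?A x - g x)) + (?A x - g x)\<^sup>2 \<partial>?M)"
    by (intro Bochner_Integration.integral_cong) (auto simp: power2_eq_square algebra_simps)
  also have "\<dots> = (\<integral>x. (h x - ?A x)\<^sup>2 \<partial>?M) + (\<integral>x. (?A x - g x)\<^sup>2 \<partial>?M)"
    using int integral_grid_constant_mult_grid_average_diff[OF g hA] by simp
  finally show ?thesis
    by (simp add: integral_nonneg_AE)
qed

text \<open>If \<open>x \<le>\<^sub>\<sigma> y\<close>, then the cell of \<open>y\<close> is the translate of the cell of \<open>x\<close> by some \<open>v\<close> with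
  \<open>z \<le>\<^sub>\<sigma> z + v\<close> for all \<open>z\<close>.\<close>

lemma grid_average_sigma_monotonic:
  assumes g: "g \<in> L2_sigma \<sigma> (cbox a b)"
  shows "sigma_monotonic \<sigma> (cbox a b) (grid_average a b n g)"
  unfolding sigma_monotonic_def
proof (intro ballI impI)
  fix x y assume x: "x \<in> cbox a b" and y: "y \<in> cbox a b" and le: "le_sigma \<sigma> x y"
  define \<kappa> \<mu> where "\<kappa> = cell_index a b n x" and "\<mu> = cell_index a b n y"
  define v :: "real ^ 'd" where "v = (\<chi> i. of_int (\<mu> i - \<kappa> i) * ((b $ i - a $ i) / 2 ^ n))"
  have \<kappa>: "\<kappa> \<in> cell_indices n" and \<mu>: "\<mu> \<in> cell_indices n"
    using cell_index_in_cell_indices[OF ab] x y by (simp_all add: \<kappa>_def \<mu>_def)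
  have mono: "\<kappa> i \<le> \<mu> i" if "x $ i \<le> y $ i" for i
    unfolding \<kappa>_def \<mu>_def using that by (rule cell_index_mono[OF ab])
  have mono': "\<mu> i \<le> \<kappa> i" if "y $ i \<le> x $ i" for i
    unfolding \<kappa>_def \<mu>_def using that by (rule cell_index_mono[OF ab])
  have step: "0 < (b $ i - a $ i) / 2 ^ n" for i
    using ab[of i] by simp
  have v: "le_sigma \<sigma> z (z + v)" for z
    unfolding le_sigma_def
  proof (intro allI conjI impI)
    fix i
    show "z $ i = (z + v) $ i" if "\<sigma> $ i = 0"
    proof -
      have "x $ i = y $ i"
        using le that by (simp add: le_sigma_def)
      then have "\<kappa> i = \<mu> i"
        using mono[of i] mono'[of i] by simp
      then show ?thesis by (simp add: v_def)
    qed
    show "of_int (\<sigma> $ i) * z $ i \<le> of_int (\<sigma> $ i) * (z + v) $ i" if s: "\<sigma> $ i = 1 \<or> \<sigma> $ i = - 1"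
    proof (cases "\<sigma> $ i = 1")
      case True
      then have "x $ i \<le> y $ i"
        using le by (auto simp: le_sigma_def dest: spec[of _ i])
      then have "0 \<le> v $ i"
        using mono[of i] step[of i] unfolding v_def vec_lambda_beta by (intro mult_nonneg_nonneg) auto
      with True show ?thesis by simp
    next
      case False
      then have \<sigma>: "\<sigma> $ i = - 1"
        using s by simp
      then have "y $ i \<le> x $ i"
        using le by (auto simp: le_sigma_def dest: spec[of _ i])
      then have "v $ i \<le> 0"
        using mono'[of i] step[of i] unfolding v_def vec_lambda_beta by (intro mult_nonpos_nonneg) auto
      with \<sigma> show ?thesis by simp
    qed
  qed
  have corner: "cell_corner a b n \<mu> - v = cell_corner a b n \<kappa>"
      "cell_corner a b n (\<lambda>i. \<mu> i + 1) - v = cell_corner a b n (\<lambda>i. \<kappa> i + 1)"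
    unfolding v_def cell_corner_def vec_eq_iff
    by (simp_all add: left_diff_distrib distrib_right diff_divide_distrib add_divide_distrib)
  obtain N where N: "N \<in> null_sets lebesgue" "sigma_monotonic \<sigma> (cbox a b - N) g"
    using g by (auto simp: L2_sigma_def)
  let ?B = "cell_box a b n"
  \<comment> \<open>A point \<open>z\<close> is bad if \<open>z\<close> or its translate
    \<open>z + v\<close> lies in \<open>N\<close>; the second condition describes \<open>N\<close>
    shifted by \<open>- v\<close>.\<close>
  let ?N = "N \<union> (+) (- v) ` N"
  have neg: "negligible ?N"
    using N(1) by (intro negligible_Un negligible_translation) (simp_all add: negligible_iff_null_sets)
  have gint: "g integrable_on ?B \<kappa>" "g integrable_on ?B \<mu>"
    using integrable_on_subcbox[OF L2_integrable_on[OF L2_sigmaD[OF g]]] cell_box_subset[OF ab] \<kappa> \<mu>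
    by (simp_all add: cell_box_def)
  have shift_int: "(\<lambda>z. g (z + v)) integrable_on ?B \<kappa>"
    using integrable_shift_cbox[of g _ _ v] gint(2) unfolding cell_box_def corner[symmetric] by blast
  have shift: "integral (?B \<kappa>) (\<lambda>z. g (z + v)) = integral (?B \<mu>) g"
    unfolding cell_box_def corner[symmetric] by (rule integral_shift_cbox)
  \<comment> \<open>On the bad set the integrand is replaced by its intended upper bound, so that
    the comparison holds at every point of the box, as \<open>integral_le\<close> demands.\<close>
  have "integral (?B \<kappa>) g = integral (?B \<kappa>) (\<lambda>z. if z \<in> ?N then g (z + v) else g z)"
    by (rule integral_spike[OF neg]) auto
  also have "\<dots> \<le> integral (?B \<kappa>) (\<lambda>z. g (z + v))"
  proof (rule integral_le)
    show "(\<lambda>z. if z \<in> ?N then g (z + v) else g z) integrable_on ?B \<kappa>"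
      by (rule integrable_spike[OF gint(1) neg]) auto
    show "(if z \<in> ?N then g (z + v) else g z) \<le> g (z + v)" if z: "z \<in> ?B \<kappa>" for z
    proof (cases "z \<in> ?N")
      case False
      have "z + v \<in> ?B \<mu>"
      proof -
        have "z \<in> cbox (cell_corner a b n \<mu> - v) (cell_corner a b n (\<lambda>i. \<mu> i + 1) - v)"
          using z unfolding corner cell_box_def .
        then show ?thesis
          unfolding cell_box_def mem_box_cart by (simp add: diff_le_eq le_diff_eq)
      qed
      then have "z \<in> cbox a b" "z + v \<in> cbox a b"
        using z cell_box_subset[OF ab] \<kappa> \<mu> by blast+
      moreover have "z + v \<notin> N"
      proof
        assume "z + v \<in> N"
        then have "- v + (z + v) \<in> (+) (- v) ` N" by blast
        then show False using False by simp
      qed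
      ultimately have "g z \<le> g (z + v)"
        using N(2) v[of z] False unfolding sigma_monotonic_def by blast
      then show ?thesis using False by simp
    qed simp
  qed (rule shift_int)
  finally have "integral (?B \<kappa>) g \<le> integral (?B \<mu>) g"
    unfolding shift .
  then show "grid_average a b n g x \<le> grid_average a b n g y"
    unfolding grid_average_def \<kappa>_def[symmetric] \<mu>_def[symmetric]
    using cell_volume_pos[of n] by (intro divide_right_mono) auto
qed

lemma S_sigma_dense:
  assumes g: "g \<in> L2_sigma \<sigma> (cbox a b)" and \<epsilon>: "0 < \<epsilon>"
  shows "\<exists>h\<in>S_sigma \<sigma> a b UNIV. L2_norm (cbox a b) (\<lambda>x. h x - g x) < \<epsilon>"
proof -
  have "grid_approximable a b g"
    by (rule grid_approximable_L2[OF ab L2_sigmaD[OF g]])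
  moreover have "0 < \<epsilon>\<^sup>2"
    using \<epsilon> by simp
  ultimately obtain n h where h: "grid_constant a b (std_grid a b n) h"
      "(\<integral>x. (h x - g x)\<^sup>2 \<partial>lebesgue_on (cbox a b)) < \<epsilon>\<^sup>2"
    unfolding grid_approximable_def by blast
  have "L2_norm (cbox a b) (\<lambda>x. grid_average a b n g x - g x) < \<epsilon>"
    unfolding L2_norm_less_iff[OF \<epsilon>]
    using grid_average_best_approximation[OF L2_sigmaD[OF g] h(1)] h(2) by linarith
  moreover have "grid_average a b n g \<in> S_sigma \<sigma> a b UNIV"
    using grid_average_sigma_monotonic[OF g] grid_average_grid_constant dyadic_grid_iff[OF ab]
    by (auto simp: S_sigma_def S_space_def dyadically_grid_constant_def)
  ultimately show ?thesis by blast
qed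

end

section \<open>The approximation theorem\<close>

theorem theorem4p4:
  fixes a b :: "real ^ 'd" and \<sigma> :: "int ^ 'd" and f w :: "real ^ 'd \<Rightarrow> real"
  assumes ab: "\<And>i. a $ i < b $ i"
    and sigma: "\<And>i. \<sigma> $ i \<in> {-1, 0, 1}"
    and f: "f \<in> L2_space (cbox a b)"
    and w: "w \<in> S_inf_pos a b"
  shows "(\<exists>(G :: nat \<Rightarrow> (real ^ 'd) set) (fn :: nat \<Rightarrow> real ^ 'd \<Rightarrow> real) (wn :: nat \<Rightarrow> real ^ 'd \<Rightarrow> real).
            (\<forall>n. dyadic_grid a b (G n) \<and> grid_constant a b (G n) (fn n) \<and>
                 grid_constant a b (G n) (wn n) \<and> (\<forall>x\<in>cbox a b. 0 < wn n x)) \<and>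
            (\<lambda>n. L2_norm (cbox a b) (\<lambda>x. fn n x - f x)) \<longlonglongrightarrow> 0 \<and>
            (\<lambda>n. Linf_norm (cbox a b) (\<lambda>x. wn n x - w x)) \<longlonglongrightarrow> 0 \<and>
            (\<lambda>n. L2_norm (cbox a b) (\<lambda>x. p_sigma \<sigma> (cbox a b) (wn n) (fn n) x
                                         - p_sigma \<sigma> (cbox a b) w f x)) \<longlonglongrightarrow> 0 \<and>
            (dyadically_grid_constant_class a b w \<longrightarrow>
              (\<forall>n. L2_norm (cbox a b) (\<lambda>x. p_sigma \<sigma> (cbox a b) w (fn n) x
                                           - p_sigma \<sigma> (cbox a b) w f x)
                   \<le> sqrt (ess_sup (cbox a b) w / ess_inf (cbox a b) w)
                      * L2_norm (cbox a b) (\<lambda>x. fn n x - f x)))) \<and>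
         (S_sigma \<sigma> a b UNIV \<subseteq> L2_sigma \<sigma> (cbox a b) \<and>
          (\<forall>g\<in>L2_sigma \<sigma> (cbox a b). \<forall>\<epsilon>>0. \<exists>h\<in>S_sigma \<sigma> a b UNIV.
              L2_norm (cbox a b) (\<lambda>x. h x - g x) < \<epsilon>))"
proof (intro conjI)
  show "S_sigma \<sigma> a b UNIV \<subseteq> L2_sigma \<sigma> (cbox a b)"
    by (rule S_sigma_subset_L2_sigma[OF ab])
  show "\<forall>g\<in>L2_sigma \<sigma> (cbox a b). \<forall>\<epsilon>>0. \<exists>h\<in>S_sigma \<sigma> a b UNIV. L2_norm (cbox a b) (\<lambda>x. h x - g x) < \<epsilon>"
    using S_sigma_dense[OF ab] by blast
  let ?Q = "cbox a b"
  obtain c K wn l where wt: "weight ?Q w c K" "\<And>n. weight ?Q (wn n) c K"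
    and wn: "\<And>n. grid_constant a b (std_grid a b (l n)) (wn n)" "\<And>n x. x \<in> ?Q \<Longrightarrow> 0 < wn n x"
    and near: "\<And>n. Linf_norm ?Q (\<lambda>x. wn n x - w x) < ereal (1 / real (Suc n))"
    using S_inf_pos_weight_approx[OF ab w] by blast
  have "grid_approximable a b f"
    by (rule grid_approximable_L2[OF ab f])
  then have "\<exists>k h. grid_constant a b (std_grid a b k) h \<and> L2_norm ?Q (\<lambda>x. h x - f x) < 1 / real (Suc n)" for n
    by (simp add: grid_approximable_def L2_norm_less_iff)
  then obtain k fn where fn: "\<And>n. grid_constant a b (std_grid a b (k n)) (fn n)"
      "\<And>n. L2_norm ?Q (\<lambda>x. fn n x - f x) < 1 / real (Suc n)"
    by metis
  have fn2: "fn n \<in> L2_space ?Q" for n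
    by (rule grid_constant_L2_space[OF ab fn(1)])
  have zero: "(\<lambda>n. 1 / real (Suc n)) \<longlonglongrightarrow> 0"
    by (rule LIMSEQ_Suc[OF lim_1_over_n])
  have fn_lim: "(\<lambda>n. L2_norm ?Q (\<lambda>x. fn n x - f x)) \<longlonglongrightarrow> 0"
  proof (rule tendsto_sandwich[OF _ _ tendsto_const zero])
    show "\<forall>\<^sub>F n in sequentially. L2_norm ?Q (\<lambda>x. fn n x - f x) \<le> 1 / real (Suc n)"
      by (intro always_eventually allI less_imp_le fn(2))
  qed simp
  have "(\<lambda>n. ereal (1 / real (Suc n))) \<longlonglongrightarrow> ereal 0"
    using zero by (rule tendsto_ereal)
  then have zero': "(\<lambda>n. ereal (1 / real (Suc n))) \<longlonglongrightarrow> 0"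
    by (simp add: zero_ereal_def)
  have wn_lim: "(\<lambda>n. Linf_norm ?Q (\<lambda>x. wn n x - w x)) \<longlonglongrightarrow> 0"
  proof (rule tendsto_sandwich[OF _ _ tendsto_const zero'])
    show "\<forall>\<^sub>F n in sequentially. 0 \<le> Linf_norm ?Q (\<lambda>x. wn n x - w x)"
      using Linf_norm_nonneg[OF ab] by simp
    show "\<forall>\<^sub>F n in sequentially. Linf_norm ?Q (\<lambda>x. wn n x - w x) \<le> ereal (1 / real (Suc n))"
      by (intro always_eventually allI less_imp_le near)
  qed
  have p_lim: "(\<lambda>n. L2_norm ?Q (\<lambda>x. p_sigma \<sigma> ?Q (wn n) (fn n) x - p_sigma \<sigma> ?Q w f x)) \<longlonglongrightarrow> 0"
    by (rule p_sigma_tendsto[OF _ f fn2 wt AE_le_Linf_norm[OF near] zero fn_lim]) simp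
  have lip: "L2_norm ?Q (\<lambda>x. p_sigma \<sigma> ?Q w (fn n) x - p_sigma \<sigma> ?Q w f x)
      \<le> sqrt (ess_sup ?Q w / ess_inf ?Q w) * L2_norm ?Q (\<lambda>x. fn n x - f x)" for n
    by (rule p_sigma_lipschitz[OF _ f fn2 weight_ess_bounds[OF ab wt(1)]]) simp
  \<comment> \<open>\<open>fn n\<close> and \<open>wn n\<close> come with unrelated levels
    \<open>k n\<close> and \<open>l n\<close>; since dyadic grids are nested, the finer of the two
    serves both.\<close>
  let ?G = "\<lambda>n. std_grid a b (max (k n) (l n))"
  have "dyadic_grid a b (?G n)" "grid_constant a b (?G n) (fn n)" "grid_constant a b (?G n) (wn n)" for n
    using dyadic_grid_iff[OF ab] grid_constant_refine[OF ab fn(1)] grid_constant_refine[OF ab wn(1)] by auto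
  then show "\<exists>G fn wn. (\<forall>n. dyadic_grid a b (G n) \<and> grid_constant a b (G n) (fn n) \<and>
                 grid_constant a b (G n) (wn n) \<and> (\<forall>x\<in>?Q. 0 < wn n x)) \<and>
            (\<lambda>n. L2_norm ?Q (\<lambda>x. fn n x - f x)) \<longlonglongrightarrow> 0 \<and>
            (\<lambda>n. Linf_norm ?Q (\<lambda>x. wn n x - w x)) \<longlonglongrightarrow> 0 \<and>
            (\<lambda>n. L2_norm ?Q (\<lambda>x. p_sigma \<sigma> ?Q (wn n) (fn n) x - p_sigma \<sigma> ?Q w f x)) \<longlonglongrightarrow> 0 \<and>
            (dyadically_grid_constant_class a b w \<longrightarrow>
              (\<forall>n. L2_norm ?Q (\<lambda>x. p_sigma \<sigma> ?Q w (fn n) x - p_sigma \<sigma> ?Q w f x)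
                   \<le> sqrt (ess_sup ?Q w / ess_inf ?Q w) * L2_norm ?Q (\<lambda>x. fn n x - f x)))"
    using wn(2) fn_lim wn_lim p_lim lip
    by (intro exI[of _ ?G] exI[of _ fn] exI[of _ wn] conjI allI impI ballI) auto
qed

end
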